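(* Let $S\subseteq\mathbb{R}^n$ be the projection of a spectrahedron. Then its closure $\overline{S}$ is again the projection of a spectrahedron.
   Context: A linear matrix polynomial of dimension $k$ in variables $Z_1,\ldots,Z_N$ is $\mathcal{A}(Z)=A_0+Z_1A_1+\cdots+Z_NA_N$ with $A_0,\ldots,A_N$ real symmetric $k\times k$ matrices. A spectrahedron in $\mathbb{R}^N$ is a set of the form $\{z\in\mathbb{R}^N\mid \mathcal{A}(z)\succeq 0\}$, where $\succeq 0$ means positive semidefinite. A set $S\subseteq\mathbb{R}^n$ is the projection of a spectrahedron if there are $m\ge 0$ and a spectrahedron $\widetilde S\subseteq\mathbb{R}^{n+m}$ with $S=\{x\in\mathbb{R}^n\mid \exists y\in\mathbb{R}^m:\ (x,y)\in\widetilde S\}$. *)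

theory Defs
  imports "HOL-Analysis.Abstract_Euclidean_Space" "Jordan_Normal_Form.Matrix"
begin

text \<open>
  The dimension \<open>m\<close> of the projected-out space is quantified inside the notion of a projection of a
  spectrahedron, so dimensions are natural numbers: \<open>\<real>\<^sup>N\<close> is
  \<^const>\<open>Euclidean_space\<close> \<open>N\<close>, whose points are the functions \<open>z\<close> of type \<^typ>\<open>nat \<Rightarrow> real\<close> with
  \<open>z i = 0\<close> for \<open>i \<ge> N\<close>. Coordinates are thus numbered \<open>0, \<dots>, N - 1\<close>.
\<close>

definition pos_semidef :: "nat \<Rightarrow> real mat \<Rightarrow> bool" where
  "pos_semidef k M \<longleftrightarrow>
     M \<in> carrier_mat k k \<and> transpose_mat M = M \<and>
     (\<forall>v \<in> carrier_vec k. 0 \<le> scalar_prod v (M *\<^sub>v v))"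

definition linear_matrix_polynomial :: "nat \<Rightarrow> nat \<Rightarrow> (nat \<Rightarrow> real mat) \<Rightarrow> bool" where
  "linear_matrix_polynomial k N A \<longleftrightarrow>
     (\<forall>i \<le> N. A i \<in> carrier_mat k k \<and> transpose_mat (A i) = A i)"

text \<open>
  The value \<open>A\<^sub>0 + z\<^sub>1 A\<^sub>1 + \<dots> + z\<^sub>N A\<^sub>N\<close>, written entrywise because the matrix type has no
  global zero for \<^const>\<open>sum\<close>. As coordinates start at \<open>0\<close>, coordinate \<open>z l\<close> multiplies \<open>A (Suc l)\<close>.
\<close>

definition lmp_eval :: "nat \<Rightarrow> nat \<Rightarrow> (nat \<Rightarrow> real mat) \<Rightarrow> (nat \<Rightarrow> real) \<Rightarrow> real mat" where
  "lmp_eval k N A z =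
     mat k k (\<lambda>(i, j). A 0 $$ (i, j) + (\<Sum>l<N. z l * A (Suc l) $$ (i, j)))"

definition spectrahedron :: "nat \<Rightarrow> (nat \<Rightarrow> real) set \<Rightarrow> bool" where
  "spectrahedron N T \<longleftrightarrow>
     (\<exists>k A. linear_matrix_polynomial k N A \<and>
        T = {z \<in> topspace (Euclidean_space N). pos_semidef k (lmp_eval k N A z)})"

text \<open>The point \<open>(x, y)\<close> of \<open>\<real>\<^sup>n\<^sup>+\<^sup>m\<close>, for \<open>x \<in> \<real>\<^sup>n\<close> and \<open>y \<in> \<real>\<^sup>m\<close>.\<close>

definition join_point :: "nat \<Rightarrow> (nat \<Rightarrow> real) \<Rightarrow> (nat \<Rightarrow> real) \<Rightarrow> nat \<Rightarrow> real" where
  "join_point n x y = (\<lambda>i. if i < n then x i else y (i - n))"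

definition projected_spectrahedron :: "nat \<Rightarrow> (nat \<Rightarrow> real) set \<Rightarrow> bool" where
  "projected_spectrahedron n S \<longleftrightarrow>
     (\<exists>m T. spectrahedron (n + m) T \<and>
        S = {x \<in> topspace (Euclidean_space n).
               \<exists>y \<in> topspace (Euclidean_space m). join_point n x y \<in> T})"

end

theory Submission
  imports Defs
begin

text \<open>
  The closure of \<open>S\<close> is the set of points satisfying every affine inequality that is valid on \<open>S\<close>.
  So it is enough to show that the affine inequalities valid on a projected spectrahedron form a
  projected spectrahedron, and to use this twice. This is semidefinite duality. Without a strictly
  feasible point, strong duality is recovered by relaxing the dual: take a feasible \<open>M\<close> with the
  smallest kernel. All feasible matrices then lie in the face of the positive semidefinite cone
  generated by \<open>M\<close>, whose elements are the sums of matrices \<open>(M w)(M w)\<^sup>T\<close>; the dual cone of this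
  face is described by the linear matrix inequality \<open>M U M \<succeq> 0\<close> in \<open>U\<close>.
\<close>

section \<open>Separation in finitely many coordinates\<close>

text \<open>The obvious certificate for a valid inequality is a positive semidefinite multiplier
  \<open>U\<close>. If no feasible matrix is positive definite, some valid inequalities may have no
  such certificate. Testing \<open>U\<close> only against the face that contains all feasible
  matrices keeps every certificate sound and turns \<open>M\<close> into a Slater point inside that
  face. As \<open>M\<close> is one fixed matrix, the relaxed condition stays linear in
  \<open>U\<close>.

  The sets to be separated are convex and miss the origin but need not be closed, so strict
  separation is not to be expected. Proper separation is enough: positivity at a single point is
  what excludes the degenerate functionals.

  An inequality \<open>l . x <= c\<close> is stored as the point \<open>(l, c)\<close>. The
  expression \<open>l . x - c\<close> is affine in \<open>(l, c)\<close> and in \<open>x\<close>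
  separately, so one duality lemma serves both times, with the two arguments exchanged.\<close>

text \<open>
  The dimension is a natural number, so the library results for \<^class>\<open>euclidean_space\<close> do not
  apply; vectors are functions of which only the values on a finite index set matter.
\<close>


definition cvx :: "('i \<Rightarrow> real) set \<Rightarrow> bool" where
  "cvx D \<longleftrightarrow> (\<forall>x\<in>D. \<forall>y\<in>D. \<forall>a b. 0 \<le> a \<longrightarrow> 0 \<le> b \<longrightarrow> a + b = 1 \<longrightarrow> (\<lambda>i. a * x i + b * y i) \<in> D)"

lemma cvxD:
  "\<lbrakk>cvx D; x \<in> D; y \<in> D; 0 \<le> a; 0 \<le> b; a + b = 1\<rbrakk> \<Longrightarrow> (\<lambda>i. a * x i + b * y i) \<in> D"
  unfolding cvx_def by blast

text \<open>
  Induction on the coordinates: if coordinate \<open>k\<close> takes both signs on \<open>D\<close>, separate the slice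
  \<open>x k = 0\<close> and choose the weight of coordinate \<open>k\<close> as in Fourier-Motzkin elimination.
\<close>

lemma proper_separation_from_zero:
  fixes D :: "('i \<Rightarrow> real) set"
  assumes "finite I" "cvx D" "D \<noteq> {}" "\<And>x. x \<in> D \<Longrightarrow> \<exists>i\<in>I. x i \<noteq> 0"
  shows "\<exists>u. (\<forall>x\<in>D. 0 \<le> (\<Sum>i\<in>I. u i * x i)) \<and> (\<exists>x\<in>D. 0 < (\<Sum>i\<in>I. u i * x i))"
  using assms
proof (induction I arbitrary: D rule: finite_induct)
  case empty
  then show ?case by auto
next
  case (insert k I)
  have ins: "(\<Sum>i\<in>insert k I. u i * x i) = u k * x k + (\<Sum>i\<in>I. u i * x i)" for u x :: "'i \<Rightarrow> real"
    using insert by simp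
  have upd: "(\<Sum>i\<in>I. (u(k := s)) i * x i) = (\<Sum>i\<in>I. u i * x i)" for u x :: "'i \<Rightarrow> real" and s
    using insert by (intro sum.cong) auto
  have unit: "(\<Sum>i\<in>insert k I. ((\<lambda>i. if i = k then s else 0) i) * x i) = s * x k" for x :: "'i \<Rightarrow> real" and s
    using insert.hyps(2) by (subst ins) (auto intro!: sum.neutral)
  show ?case
  proof (cases "(\<exists>x\<in>D. x k > 0) \<and> (\<exists>x\<in>D. x k < 0)")
    case False
    show ?thesis
    proof (cases "\<exists>x\<in>D. x k \<noteq> 0")
      case True
      then obtain x where x: "x \<in> D" "x k \<noteq> 0" by blast
      \<comment> \<open>Coordinate \<open>k\<close> does not change sign on \<open>D\<close> and is
        nonzero somewhere, so up to sign it separates by itself.\<close>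
      define s :: real where "s = sgn (x k)"
      have "0 \<le> s * y k" if "y \<in> D" for y
      proof (cases "x k > 0")
        case True
        then have "\<not> y k < 0" using False x(1) that by blast
        then show ?thesis using True by (simp add: s_def)
      next
        case neg: False
        then have "x k < 0" using x(2) by simp
        then have "\<not> y k > 0" using False x(1) that by blast
        then show ?thesis using \<open>x k < 0\<close> by (simp add: s_def)
      qed
      moreover have "0 < s * x k" using x unfolding s_def by (auto simp: sgn_real_def)
      ultimately show ?thesis using x
        by (intro exI[of _ "\<lambda>i. if i = k then s else 0"]) (auto simp: unit simp del: sum.insert)
    next
      case False
      then have "\<exists>i\<in>I. x i \<noteq> 0" if "x \<in> D" for x using insert.prems(3)[OF that] that by auto
      then obtain u where u: "\<forall>x\<in>D. 0 \<le> (\<Sum>i\<in>I. u i * x i)" "\<exists>x\<in>D. 0 < (\<Sum>i\<in>I. u i * x i)"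
        using insert.IH[OF insert.prems(1,2)] by blast
      moreover have "(\<Sum>i\<in>insert k I. u i * x i) = (\<Sum>i\<in>I. u i * x i)" if "x \<in> D" for x
        using False that by (simp add: ins del: sum.insert)
      ultimately show ?thesis by (intro exI[of _ u]) (simp del: sum.insert)
    qed
  next
    case True
    then obtain p q where p: "p \<in> D" "p k > 0" and q: "q \<in> D" "q k < 0" by blast
    define E where "E = {x \<in> D. x k = 0}"
    \<comment> \<open>The weights cancel coordinate \<open>k\<close>: this is where the segment from
      \<open>x\<close> to \<open>y\<close> crosses the slice \<open>E\<close>.\<close>
    define mix where "mix x y = (\<lambda>i. (- y k / (x k - y k)) * x i + (x k / (x k - y k)) * y i)" for x y :: "'i \<Rightarrow> real"
    have mix: "mix x y \<in> E" if "x \<in> D" "x k > 0" "y \<in> D" "y k < 0" for x y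
    proof -
      have "- y k / (x k - y k) + x k / (x k - y k) = 1"
        using that by (simp add: diff_divide_distrib[symmetric])
      then have "mix x y \<in> D" unfolding mix_def using that insert.prems(1)
        by (intro cvxD) (auto intro: divide_nonneg_pos divide_nonpos_pos)
      moreover have "mix x y k = 0" unfolding mix_def using that by (simp add: field_simps)
      ultimately show ?thesis unfolding E_def by simp
    qed
    have "cvx E" using insert.prems(1) unfolding cvx_def E_def by auto
    moreover have "E \<noteq> {}" using mix[OF p q] by auto
    moreover have "\<exists>i\<in>I. x i \<noteq> 0" if "x \<in> E" for x
      using insert.prems(3)[of x] that by (auto simp: E_def)
    ultimately obtain u where u: "\<forall>x\<in>E. 0 \<le> (\<Sum>i\<in>I. u i * x i)" "\<exists>x\<in>E. 0 < (\<Sum>i\<in>I. u i * x i)"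
      using insert.IH by blast
    define L where "L x = (\<Sum>i\<in>I. u i * x i)" for x
    have Lmix: "L (mix x y) = (- y k * L x + x k * L y) / (x k - y k)" for x y
    proof -
      have lin: "L (\<lambda>i. a * x i + b * y i) = a * L x + b * L y" for a b
        unfolding L_def sum_distrib_left sum.distrib[symmetric]
        by (intro sum.cong) (simp_all add: distrib_left mult.left_commute)
      show ?thesis unfolding mix_def lin by (simp add: add_divide_distrib diff_divide_distrib)
    qed
    have ord: "- L x / x k \<le> L y / (- y k)" if "x \<in> D" "x k > 0" "y \<in> D" "y k < 0" for x y
    proof -
      have "0 \<le> L (mix x y)" using u(1) mix[OF that] by (auto simp: L_def)
      then have "0 \<le> - y k * L x + x k * L y" unfolding Lmix using that by (simp add: zero_le_divide_iff)
      then show ?thesis using that by (simp add: field_simps)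
    qed
    \<comment> \<open>For \<open>x k > 0\<close> the goal \<open>0 <= s * x k + L x\<close> is a
      lower bound on \<open>s\<close>, for \<open>x k < 0\<close> an upper bound. By
      \<open>ord\<close> no lower bound exceeds an upper bound.\<close>
    define W where "W = {- L x / x k | x. x \<in> D \<and> x k > 0}"
    define s where "s = Sup W"
    have ne: "W \<noteq> {}" using p unfolding W_def by blast
    have bdd: "bdd_above W" unfolding W_def bdd_above_def using ord[OF _ _ q] by blast
    have up: "- L x / x k \<le> s" if "x \<in> D" "x k > 0" for x
      unfolding s_def using that by (intro cSup_upper bdd) (auto simp: W_def)
    have low: "s \<le> L y / (- y k)" if "y \<in> D" "y k < 0" for y
      unfolding s_def using that ord by (intro cSup_least ne) (auto simp: W_def)
    have nonneg: "0 \<le> s * x k + L x" if "x \<in> D" for x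
    proof (cases "x k" "0::real" rule: linorder_cases)
      case less
      then show ?thesis using low[OF that] by (simp add: field_simps)
    next
      case equal
      then show ?thesis using u(1) that by (auto simp: E_def L_def)
    next
      case greater
      then show ?thesis using up[OF that] by (simp add: field_simps)
    qed
    have eq: "(\<Sum>i\<in>insert k I. (u(k := s)) i * x i) = s * x k + L x" for x
      unfolding L_def by (subst ins, subst upd) simp
    \<comment> \<open>Strict positivity is inherited from the slice, where the weight
      \<open>s\<close> has no effect.\<close>
    obtain x where "x \<in> D" "x k = 0" "0 < L x" using u(2) unfolding E_def L_def by blast
    then have "\<exists>x\<in>D. 0 < s * x k + L x" by (intro bexI[of _ x]) simp_all
    then show ?thesis using nonneg by (intro exI[of _ "u(k := s)"]) (simp only: eq, blast)
  qed
qed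

text \<open>Gaussian elimination: a form \<open>p\<close> that is nonzero at \<open>k\<close>
  removes coordinate \<open>k\<close> from all the others. The purpose is to let the common kernel
  of infinitely many feasible matrices depend on finitely many of their rows.\<close>

lemma finitely_many_forms:
  fixes R :: "('i \<Rightarrow> real) set"
  assumes "finite I"
  shows "\<exists>F. finite F \<and> F \<subseteq> R \<and>
    (\<forall>x. (\<forall>r\<in>F. (\<Sum>i\<in>I. r i * x i) = 0) \<longrightarrow> (\<forall>r\<in>R. (\<Sum>i\<in>I. r i * x i) = 0))"
  using assms
proof (induction I arbitrary: R rule: finite_induct)
  case empty
  then show ?case by auto
next
  case (insert k I)
  show ?case
  proof (cases "\<forall>r\<in>R. r k = 0")
    case True
    obtain F where F: "finite F" "F \<subseteq> R"
      "\<And>x. (\<forall>r\<in>F. (\<Sum>i\<in>I. r i * x i) = 0) \<Longrightarrow> (\<forall>r\<in>R. (\<Sum>i\<in>I. r i * x i) = 0)"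
      using insert.IH[of R] by blast
    have "(\<Sum>i\<in>insert k I. r i * x i) = (\<Sum>i\<in>I. r i * x i)" if "r \<in> R" for r x
      using insert True that by simp
    then show ?thesis using F by (intro exI[of _ F]) (auto simp: subset_iff simp del: sum.insert)
  next
    case False
    then obtain p where p: "p \<in> R" "p k \<noteq> 0" by blast
    define red where "red r = (\<lambda>i. r i - r k / p k * p i)" for r :: "'i \<Rightarrow> real"
    have red: "(\<Sum>i\<in>I. red r i * x i) = (\<Sum>i\<in>insert k I. r i * x i) - r k / p k * (\<Sum>i\<in>insert k I. p i * x i)" for r x
      using insert(1,2) p unfolding red_def
      by (simp add: algebra_simps sum_subtractf sum_distrib_left)
    obtain G where G: "finite G" "G \<subseteq> red ` R"
      "\<And>x. (\<forall>r\<in>G. (\<Sum>i\<in>I. r i * x i) = 0) \<Longrightarrow> (\<forall>r\<in>red ` R. (\<Sum>i\<in>I. r i * x i) = 0)"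
      using insert.IH[of "red ` R"] by blast
    obtain F where F: "finite F" "F \<subseteq> R" "G = red ` F"
      using finite_subset_image[OF G(1,2)] by blast
    have "(\<Sum>i\<in>insert k I. r i * x i) = 0"
      if x: "\<forall>r\<in>insert p F. (\<Sum>i\<in>insert k I. r i * x i) = 0" and r: "r \<in> R" for x r
    proof -
      have px: "(\<Sum>i\<in>insert k I. p i * x i) = 0" using x by blast
      have "(\<Sum>i\<in>I. red r i * x i) = 0" if "r \<in> F" for r
        unfolding red px using x that by (simp del: sum.insert)
      then have "(\<Sum>i\<in>I. red r i * x i) = 0" using G(3)[of x] r unfolding F(3) by blast
      then show ?thesis unfolding red px by (simp del: sum.insert)
    qed
    then show ?thesis using F p by (intro exI[of _ "insert p F"]) blast
  qed
qed

section \<open>Positive semidefinite matrices\<close>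

definition qf :: "'i set \<Rightarrow> ('i \<Rightarrow> 'i \<Rightarrow> real) \<Rightarrow> ('i \<Rightarrow> real) \<Rightarrow> real" where
  "qf J B w = (\<Sum>i\<in>J. \<Sum>j\<in>J. w i * w j * B i j)"

text \<open>Symmetry is left out so that later inequalities may have arbitrary coefficient matrices;
  \<open>psd_symmetrize\<close> brings it back.\<close>

definition psd :: "'i set \<Rightarrow> ('i \<Rightarrow> 'i \<Rightarrow> real) \<Rightarrow> bool" where
  "psd J B \<longleftrightarrow> (\<forall>w. 0 \<le> qf J B w)"

definition mv :: "'i set \<Rightarrow> ('i \<Rightarrow> 'i \<Rightarrow> real) \<Rightarrow> ('i \<Rightarrow> real) \<Rightarrow> 'i \<Rightarrow> real" where
  "mv J B w i = (\<Sum>j\<in>J. B i j * w j)"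

text \<open>Independent of an index set, so that it survives the shrinking of \<open>J\<close> in
  inductions.\<close>

definition symm :: "('i \<Rightarrow> 'i \<Rightarrow> real) \<Rightarrow> bool" where
  "symm B \<longleftrightarrow> (\<forall>i j. B i j = B j i)"

lemma qf_mv: "qf J B w = (\<Sum>i\<in>J. w i * mv J B w i)"
  by (simp add: qf_def mv_def sum_distrib_left mult_ac)

lemma symmD: "symm B \<Longrightarrow> B i j = B j i"
  by (simp add: symm_def)

lemma mv_adjoint:
  assumes "symm B"
  shows "(\<Sum>i\<in>J. v i * mv J B w i) = (\<Sum>i\<in>J. mv J B v i * w i)"
  unfolding mv_def sum_distrib_left sum_distrib_right
  by (subst sum.swap) (intro sum.cong refl, metis symmD[OF assms] mult.assoc mult.commute)

lemma qf_add_scaled: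
  assumes "symm B"
  shows "qf J B (\<lambda>i. v i + t * w i) = qf J B v + 2 * t * (\<Sum>i\<in>J. w i * mv J B v i) + t\<^sup>2 * qf J B w"
proof -
  have a: "mv J B (\<lambda>i. v i + t * w i) i = mv J B v i + t * mv J B w i" for i
    unfolding mv_def sum_distrib_left sum.distrib[symmetric]
    by (intro sum.cong) (simp_all add: distrib_left mult.left_commute)
  have b: "(\<Sum>i\<in>J. v i * mv J B w i) = (\<Sum>i\<in>J. w i * mv J B v i)"
    using mv_adjoint[OF assms, where J = J and v = v and w = w] by (simp add: mult.commute)
  have "qf J B (\<lambda>i. v i + t * w i) = (\<Sum>i\<in>J. v i * mv J B v i + t * (v i * mv J B w i)
      + t * (w i * mv J B v i) + t\<^sup>2 * (w i * mv J B w i))"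
    unfolding qf_mv a by (intro sum.cong) (simp_all add: algebra_simps power2_eq_square)
  also have "\<dots> = qf J B v + t * (\<Sum>i\<in>J. v i * mv J B w i) + t * (\<Sum>i\<in>J. w i * mv J B v i) + t\<^sup>2 * qf J B w"
    by (simp only: sum.distrib sum_distrib_left qf_mv)
  finally show ?thesis unfolding b by simp
qed

text \<open>The discriminant of a nonnegative quadratic; for \<open>c > 0\<close> its minimum is at
  \<open>t = - b / c\<close>.\<close>

lemma quadratic_nonneg:
  fixes a b c :: real
  assumes "\<And>t. 0 \<le> a + 2 * t * b + t\<^sup>2 * c" and "0 \<le> c"
  shows "b\<^sup>2 \<le> a * c"
proof (cases "c = 0")
  case True
  have "b = 0"
  proof (rule ccontr)
    assume "b \<noteq> 0"
    \<comment> \<open>At this \<open>t\<close> the expression equals \<open>- 1\<close>.\<close>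
    then show False using assms(1)[of "- (a + 1) / (2 * b)"] True by (simp add: field_simps)
  qed
  then show ?thesis using True by simp
next
  case False
  then have c: "c > 0" using assms(2) by simp
  have "0 \<le> c * (a + 2 * (- b / c) * b + (- b / c)\<^sup>2 * c)"
    using assms(1)[of "- b / c"] c by (intro mult_nonneg_nonneg) auto
  also have "\<dots> = a * c - b\<^sup>2" using c by (simp add: field_simps power2_eq_square)
  finally show ?thesis by simp
qed


lemma psd_cauchy:
  assumes "symm B" "psd J B"
  shows "(\<Sum>i\<in>J. w i * mv J B v i)\<^sup>2 \<le> qf J B v * qf J B w"
proof (rule quadratic_nonneg)
  show "0 \<le> qf J B v + 2 * t * (\<Sum>i\<in>J. w i * mv J B v i) + t\<^sup>2 * qf J B w" for t
    using assms(2) unfolding qf_add_scaled[OF assms(1), symmetric] psd_def by blast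
  show "0 \<le> qf J B w" using assms(2) unfolding psd_def by blast
qed

text \<open>Cauchy-Schwarz with \<open>mv J B v\<close> itself as the second vector. So the kernel
  of a semidefinite matrix is the zero set of its form, and the kernel of a sum is the intersection
  of the kernels.\<close>

lemma psd_qf_eq_0:
  assumes "symm B" "psd J B" "finite J" "qf J B v = 0" "i \<in> J"
  shows "mv J B v i = 0"
proof -
  have "(\<Sum>j\<in>J. mv J B v j * mv J B v j)\<^sup>2 \<le> 0"
    using psd_cauchy[OF assms(1,2), of "mv J B v" v] assms(4) by simp
  then have "(\<Sum>j\<in>J. mv J B v j * mv J B v j) = 0" by simp
  then show ?thesis using assms(3,5) by (subst (asm) sum_nonneg_eq_0_iff) auto
qed

lemma mv_zero_qf: "(\<And>i. i \<in> J \<Longrightarrow> mv J B v i = 0) \<Longrightarrow> qf J B v = 0"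
  by (simp add: qf_mv)

lemma qf_cong:
  "(\<And>i j. i \<in> J \<Longrightarrow> j \<in> J \<Longrightarrow> B i j = C i j) \<Longrightarrow> (\<And>i. i \<in> J \<Longrightarrow> v i = w i) \<Longrightarrow> qf J B v = qf J C w"
  unfolding qf_def by (intro sum.cong) auto

lemma psd_cong:
  "(\<And>i j. i \<in> J \<Longrightarrow> j \<in> J \<Longrightarrow> B i j = C i j) \<Longrightarrow> psd J B = psd J C"
  unfolding psd_def using qf_cong[of J B C] by simp

lemma qf_lincomb: "qf J (\<lambda>i j. a * B i j + b * C i j) w = a * qf J B w + b * qf J C w"
  unfolding qf_def by (simp add: distrib_left sum.distrib sum_distrib_left mult.left_commute)

lemma qf_sum: "qf J (\<lambda>i j. \<Sum>s\<in>T. B s i j) w = (\<Sum>s\<in>T. qf J (B s) w)"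
proof -
  have "qf J (\<lambda>i j. \<Sum>s\<in>T. B s i j) w = (\<Sum>i\<in>J. \<Sum>s\<in>T. \<Sum>j\<in>J. w i * w j * B s i j)"
    unfolding qf_def sum_distrib_left by (intro sum.cong refl sum.swap)
  also have "\<dots> = (\<Sum>s\<in>T. qf J (B s) w)" unfolding qf_def by (rule sum.swap)
  finally show ?thesis .
qed

lemma qf_outer: "qf J (\<lambda>i j. b i * b j) w = (\<Sum>i\<in>J. w i * b i)\<^sup>2"
  unfolding qf_def power2_eq_square sum_product by (intro sum.cong) (simp_all add: mult_ac)

lemma qf_insert:
  assumes "finite J" "k \<notin> J" "symm B"
  shows "qf (insert k J) B w = w k * w k * B k k + 2 * w k * (\<Sum>j\<in>J. w j * B k j) + qf J B w"
proof -
  have "qf (insert k J) B w = w k * w k * B k k + (\<Sum>j\<in>J. w k * w j * B k j)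
     + (\<Sum>i\<in>J. w i * w k * B i k) + qf J B w"
    unfolding qf_def using assms(1,2) by (simp add: sum.distrib)
  moreover have "(\<Sum>i\<in>J. w i * w k * B i k) = w k * (\<Sum>j\<in>J. w j * B k j)"
    unfolding sum_distrib_left by (simp add: symmD[OF assms(3), of _ k] mult_ac)
  moreover have "(\<Sum>j\<in>J. w k * w j * B k j) = w k * (\<Sum>j\<in>J. w j * B k j)"
    unfolding sum_distrib_left by (simp add: mult.assoc)
  ultimately show ?thesis by simp
qed

text \<open>Cholesky elimination, which avoids eigenvalues: a positive pivot splits off one rank-one
  term and leaves a semidefinite Schur complement, and a zero pivot forces its whole row to be
  zero.\<close>

lemma psd_sum_of_outer:
  fixes B :: "'i \<Rightarrow> 'i \<Rightarrow> real"
  assumes "finite J" "symm B" "psd J B"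
  shows "\<exists>(r::nat) b. \<forall>i\<in>J. \<forall>j\<in>J. B i j = (\<Sum>s<r. b s i * b s j)"
  using assms
proof (induction J arbitrary: B rule: finite_induct)
  case empty
  then show ?case by auto
next
  case (insert k J)
  note ins = qf_insert[OF insert.hyps insert.prems(1)]
  have pos: "0 \<le> w k * w k * B k k + 2 * w k * (\<Sum>j\<in>J. w j * B k j) + qf J B w" for w
    using insert.prems(2) unfolding psd_def ins by blast
  have off: "qf J B (\<lambda>i. if i = k then 1 else 0) = 0" "(\<Sum>j\<in>J. (if j = k then 1 else 0) * B k j) = 0"
    unfolding qf_def using insert.hyps(2) by (auto intro!: sum.neutral)
  have kk: "0 \<le> B k k"
    using pos[of "\<lambda>i. if i = k then 1 else 0"] unfolding off by simp
  show ?case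
  proof (cases "B k k = 0")
    case True
    have pJ: "psd J B" unfolding psd_def
    proof
      fix w
      have "qf J B (w(k := 0)) = qf J B w" using insert.hyps by (intro qf_cong) auto
      then show "0 \<le> qf J B w" using pos[of "w(k := 0)"] by simp
    qed
    \<comment> \<open>The unit vector at \<open>k\<close> has form value \<open>B k k = 0\<close>,
      hence lies in the kernel.\<close>
    have k0: "B k j = 0" if "j \<in> insert k J" for j
    proof -
      have "qf (insert k J) B (\<lambda>i. if i = k then 1 else 0) = 0"
        unfolding ins off using True by simp
      then have "mv (insert k J) B (\<lambda>i. if i = k then 1 else 0) j = 0"
        using insert.prems insert.hyps(1) that by (intro psd_qf_eq_0) auto
      moreover have "mv (insert k J) B (\<lambda>i. if i = k then 1 else 0) j = B j k"
        using insert.hyps unfolding mv_def by (simp add: if_distrib[of "\<lambda>x. _ * x"] cong: if_cong)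
      ultimately show ?thesis using symmD[OF insert.prems(1)] by metis
    qed
    obtain r :: nat and b where b: "\<forall>i\<in>J. \<forall>j\<in>J. B i j = (\<Sum>s<r. b s i * b s j)"
      using insert.IH[OF insert.prems(1) pJ] by blast
    have "B i j = (\<Sum>s<r. ((b s)(k := 0)) i * ((b s)(k := 0)) j)" if "i \<in> insert k J" "j \<in> insert k J" for i j
    proof (cases "i = k \<or> j = k")
      case True
      then show ?thesis using k0[OF that(1)] k0[OF that(2)] symmD[OF insert.prems(1), of i j] by auto
    next
      case False
      then show ?thesis using that b by auto
    qed
    then show ?thesis by (intro exI[of _ r] exI[of _ "\<lambda>s. (b s)(k := 0)"]) blast
  next
    case False
    then have kp: "B k k > 0" using kk by simp
    define C where "C = (\<lambda>i j. B i j - B k i * B k j / B k k)"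
    have sC: "symm C" unfolding C_def symm_def
    proof (intro allI)
      show "B i j - B k i * B k j / B k k = B j i - B k j * B k i / B k k" for i j
        using symmD[OF insert.prems(1), of i j] by (simp add: mult.commute)
    qed
    have pC: "psd J C" unfolding psd_def
    proof
      fix w
      define \<beta> where "\<beta> = (\<Sum>j\<in>J. w j * B k j)"
      \<comment> \<open>The value at \<open>k\<close> minimizes the form of \<open>B\<close> for the
        given other coordinates; the minimum is the form of \<open>C\<close>.\<close>
      define v where "v = w(k := - \<beta> / B k k)"
      have v: "qf J B v = qf J B w" "(\<Sum>j\<in>J. v j * B k j) = \<beta>"
        using insert.hyps unfolding v_def \<beta>_def by (auto intro!: qf_cong sum.cong)
      have "qf J C w = qf J B w - \<beta>\<^sup>2 / B k k"
        using qf_lincomb[of J 1 B "- 1 / B k k" "\<lambda>i j. B k i * B k j" w]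
        unfolding qf_outer C_def \<beta>_def by simp
      also have "\<dots> = v k * v k * B k k + 2 * v k * (\<Sum>j\<in>J. v j * B k j) + qf J B v"
        unfolding v using kp by (simp add: v_def field_simps power2_eq_square)
      finally show "0 \<le> qf J C w" using pos[of v] by simp
    qed
    obtain r :: nat and b where b: "\<forall>i\<in>J. \<forall>j\<in>J. C i j = (\<Sum>s<r. b s i * b s j)"
      using insert.IH[OF sC pC] by blast
    \<comment> \<open>The vectors found for \<open>C\<close> are made to vanish at \<open>k\<close>;
      the new index \<open>r\<close> holds the normalized pivot row.\<close>
    define c where "c s = (if s < r then (b s)(k := 0) else (\<lambda>i. B k i / sqrt (B k k)))" for s
    have "B i j = (\<Sum>s<Suc r. c s i * c s j)" if "i \<in> insert k J" "j \<in> insert k J" for i j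
    proof -
      have "(\<Sum>s<r. c s i * c s j) = C i j"
      proof (cases "i = k \<or> j = k")
        case True
        then show ?thesis using kp symmD[OF insert.prems(1), of i j] by (auto simp: c_def C_def)
      next
        case False
        then show ?thesis using that b by (auto simp: c_def)
      qed
      then show ?thesis using kp by (simp add: C_def c_def)
    qed
    then show ?thesis by blast
  qed
qed

text \<open>If \<open>b\<close> were outside the range, some \<open>u\<close> would properly
  separate the affine space of all \<open>M w - b\<close> from the origin. A linear function of
  \<open>w\<close> that is bounded below vanishes, so \<open>M u = 0\<close>; then \<open>b\<close>
  is orthogonal to \<open>u\<close>, and the functional is zero on the whole affine space.\<close>

lemma in_range_if_orthogonal_to_kernel:
  fixes M :: "'i \<Rightarrow> 'i \<Rightarrow> real"
  assumes "finite J" "symm M"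
    and "\<And>x. (\<And>i. i \<in> J \<Longrightarrow> mv J M x i = 0) \<Longrightarrow> (\<Sum>i\<in>J. b i * x i) = 0"
  shows "\<exists>w. \<forall>i\<in>J. b i = mv J M w i"
proof (rule ccontr)
  assume no: "\<nexists>w. \<forall>i\<in>J. b i = mv J M w i"
  have mv_lin: "mv J M (\<lambda>i. s * v i + t * w i) i = s * mv J M v i + t * mv J M w i" for s t v w i
    unfolding mv_def sum_distrib_left sum.distrib[symmetric]
    by (intro sum.cong) (simp_all add: distrib_left mult.left_commute)
  define D where "D = range (\<lambda>w i. mv J M w i - b i)"
  have "cvx D" unfolding cvx_def
  proof (intro ballI allI impI)
    fix x y and s t :: real
    assume "x \<in> D" "y \<in> D" and st: "s + t = 1"
    then obtain v w where x: "x = (\<lambda>i. mv J M v i - b i)" and y: "y = (\<lambda>i. mv J M w i - b i)"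
      unfolding D_def by blast
    have "s * x i + t * y i = mv J M (\<lambda>i. s * v i + t * w i) i - b i" for i
    proof -
      have "s * b i + t * b i = b i" using st by (metis distrib_right mult_1)
      then show ?thesis unfolding mv_lin x y by (simp add: algebra_simps)
    qed
    then show "(\<lambda>i. s * x i + t * y i) \<in> D" unfolding D_def by auto
  qed
  moreover have "\<exists>i\<in>J. x i \<noteq> 0" if xD: "x \<in> D" for x
  proof -
    obtain w where x: "x = (\<lambda>i. mv J M w i - b i)" using xD unfolding D_def by auto
    obtain i where "i \<in> J" "b i \<noteq> mv J M w i" using no by blast
    then show ?thesis unfolding x by (intro bexI[of _ i]) simp_all
  qed
  moreover have "D \<noteq> {}" unfolding D_def by simp
  ultimately obtain u where u: "\<And>x. x \<in> D \<Longrightarrow> 0 \<le> (\<Sum>i\<in>J. u i * x i)" "\<exists>x\<in>D. 0 < (\<Sum>i\<in>J. u i * x i)"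
    using proper_separation_from_zero[OF assms(1), of D] by blast
  have ev: "(\<Sum>i\<in>J. u i * (mv J M w i - b i)) = (\<Sum>i\<in>J. mv J M u i * w i) - (\<Sum>i\<in>J. b i * u i)" for w
    unfolding mv_adjoint[OF assms(2), symmetric] by (simp add: right_diff_distrib sum_subtractf mult.commute)
  have lb: "(\<Sum>i\<in>J. b i * u i) \<le> (\<Sum>i\<in>J. mv J M u i * w i)" for w
    using u(1)[of "\<lambda>i. mv J M w i - b i"] unfolding ev D_def by simp
  have "mv J M u i = 0" if i: "i \<in> J" for i
  proof (rule ccontr)
    assume n: "mv J M u i \<noteq> 0"
    define \<beta> where "\<beta> = (\<Sum>i\<in>J. b i * u i)"
    \<comment> \<open>A test vector supported at \<open>i\<close> gives the linear function the
      value \<open>\<beta> - 1\<close>, below its bound \<open>\<beta>\<close>.\<close>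
    have "\<beta> \<le> (\<Sum>j\<in>J. mv J M u j * (if j = i then (\<beta> - 1) / mv J M u i else 0))"
      unfolding \<beta>_def by (rule lb)
    also have "\<dots> = \<beta> - 1" using i n assms(1) by (simp add: if_distrib cong: if_cong)
    finally show False by simp
  qed
  then have "(\<Sum>i\<in>J. mv J M u i * w i) = 0" "(\<Sum>i\<in>J. b i * u i) = 0" for w
    using assms(3)[of u] by auto
  then show False using u(2) unfolding D_def by (auto simp: ev)
qed


section \<open>Duality for linear matrix inequalities\<close>

definition aff :: "nat \<Rightarrow> (nat \<Rightarrow> real) \<Rightarrow> (nat \<Rightarrow> real) \<Rightarrow> real" where
  "aff N c z = c 0 + (\<Sum>l<N. z l * c (Suc l))"

lemma aff_lincomb: "aff N (\<lambda>l. a * c l + b * d l) z = a * aff N c z + b * aff N d z"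
  unfolding aff_def by (simp add: distrib_left sum.distrib sum_distrib_left mult.left_commute)

lemma aff_sum: "aff N (\<lambda>l. \<Sum>i\<in>I. c i l) z = (\<Sum>i\<in>I. aff N (c i) z)"
proof -
  have "(\<Sum>l<N. z l * (\<Sum>i\<in>I. c i (Suc l))) = (\<Sum>i\<in>I. \<Sum>l<N. z l * c i (Suc l))"
    unfolding sum_distrib_left by (rule sum.swap)
  then show ?thesis unfolding aff_def by (simp add: sum.distrib)
qed

lemma aff_mult: "aff N (\<lambda>l. u * c l) z = u * aff N c z"
  using aff_lincomb[of N u c 0 c z] by simp

lemma aff_convex:
  assumes "a + b = 1"
  shows "aff N c (\<lambda>i. a * x i + b * y i) = a * aff N c x + b * aff N c y"
proof -
  have "a * c 0 + b * c 0 = c 0" using assms by (metis distrib_right mult_1)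
  then show ?thesis unfolding aff_def
    by (simp add: distrib_left distrib_right sum.distrib sum_distrib_left mult.assoc)
qed

text \<open>A nonconstant affine function is unbounded above. This trades a condition on all
  \<open>z\<close> for finitely many conditions on coefficients.\<close>

lemma aff_nonpos_iff: "(\<forall>z. aff N c z \<le> 0) \<longleftrightarrow> c 0 \<le> 0 \<and> (\<forall>l<N. c (Suc l) = 0)"
proof
  assume *: "\<forall>z. aff N c z \<le> 0"
  have single: "c 0 + s * c (Suc l) \<le> 0" if "l < N" for l s
  proof -
    have "aff N c (\<lambda>i. if i = l then s else 0) = c 0 + s * c (Suc l)"
      using that unfolding aff_def by (simp add: if_distrib[of "\<lambda>x. x * _"] cong: if_cong)
    then show ?thesis using * by metis
  qed
  have "c (Suc l) = 0" if "l < N" for l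
  proof (rule ccontr)
    assume "c (Suc l) \<noteq> 0"
    then show False using single[OF that, of "(1 - c 0) / c (Suc l)"] by simp
  qed
  moreover have "c 0 \<le> 0" using *[rule_format, of "\<lambda>_. 0"] by (simp add: aff_def)
  ultimately show "c 0 \<le> 0 \<and> (\<forall>l<N. c (Suc l) = 0)" by blast
qed (simp add: aff_def)

text \<open>The trace inner product of matrices, for \<open>U\<close> that need not be
  symmetric.\<close>

definition pairing :: "'i set \<Rightarrow> ('i \<Rightarrow> 'i \<Rightarrow> real) \<Rightarrow> ('i \<Rightarrow> 'i \<Rightarrow> real) \<Rightarrow> real" where
  "pairing J U B = (\<Sum>i\<in>J. \<Sum>j\<in>J. U i j * B i j)"

lemma pairing_lincomb:
  "pairing J U (\<lambda>i j. a * B i j + b * C i j) = a * pairing J U B + b * pairing J U C"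
  unfolding pairing_def by (simp add: distrib_left sum.distrib sum_distrib_left mult.left_commute)

lemma pairing_scale: "pairing J (\<lambda>i j. U i j / c) B = pairing J U B / c"
  unfolding pairing_def by (simp add: sum_divide_distrib)

lemma pairing_diff: "pairing J U (\<lambda>i j. B i j - C i j) = pairing J U B - pairing J U C"
  using pairing_lincomb[of J U 1 B "-1" C] by simp

lemma pairing_aff: "pairing J U (\<lambda>i j. aff N (\<lambda>l. A l i j) z) = aff N (\<lambda>l. pairing J U (A l)) z"
  unfolding pairing_def by (simp add: aff_sum aff_mult)

lemma pairing_sum: "pairing J U (\<lambda>i j. \<Sum>s\<in>T. B s i j) = (\<Sum>s\<in>T. pairing J U (B s))"
proof -
  have "pairing J U (\<lambda>i j. \<Sum>s\<in>T. B s i j) = (\<Sum>i\<in>J. \<Sum>s\<in>T. \<Sum>j\<in>J. U i j * B s i j)"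
    unfolding pairing_def sum_distrib_left by (intro sum.cong refl sum.swap)
  also have "\<dots> = (\<Sum>s\<in>T. pairing J U (B s))" unfolding pairing_def by (rule sum.swap)
  finally show ?thesis .
qed

lemma pairing_cong: "(\<And>i j. i \<in> J \<Longrightarrow> j \<in> J \<Longrightarrow> B i j = C i j) \<Longrightarrow> pairing J U B = pairing J U C"
  unfolding pairing_def by (intro sum.cong) auto

section \<open>Faces of the positive semidefinite cone, described by kernels\<close>

definition ker_le :: "'i set \<Rightarrow> ('i \<Rightarrow> 'i \<Rightarrow> real) \<Rightarrow> ('i \<Rightarrow> 'i \<Rightarrow> real) \<Rightarrow> bool" where
  "ker_le J M B \<longleftrightarrow> (\<forall>x. (\<forall>i\<in>J. mv J M x i = 0) \<longrightarrow> (\<forall>i\<in>J. mv J B x i = 0))"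

lemma mv_lincomb_mat: "mv J (\<lambda>i j. a * B i j + b * C i j) x i = a * mv J B x i + b * mv J C x i"
  unfolding mv_def by (simp add: distrib_right sum.distrib sum_distrib_left mult.assoc)

lemma symm_lincomb: "symm B \<Longrightarrow> symm C \<Longrightarrow> symm (\<lambda>i j. a * B i j + b * C i j)"
  unfolding symm_def by metis

lemma psd_lincomb:
  "psd J B \<Longrightarrow> psd J C \<Longrightarrow> 0 \<le> a \<Longrightarrow> 0 \<le> b \<Longrightarrow> psd J (\<lambda>i j. a * B i j + b * C i j)"
  unfolding psd_def qf_lincomb by simp

lemma ker_le_lincomb:
  "ker_le J M B \<Longrightarrow> ker_le J M C \<Longrightarrow> ker_le J M (\<lambda>i j. a * B i j + b * C i j)"
  unfolding ker_le_def mv_lincomb_mat by simp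

text \<open>Write \<open>B\<close> as a sum of outer products of vectors \<open>b s\<close>. At a
  kernel vector of \<open>M\<close> the form of \<open>B\<close>, a sum of squares of products with
  the \<open>b s\<close>, is zero. So each \<open>b s\<close> is orthogonal to the kernel and lies
  in the range of \<open>M\<close>.\<close>

lemma psd_face_decomp:
  assumes "finite J" "symm M" "symm B" "psd J B" "ker_le J M B"
  shows "\<exists>(r::nat) w. \<forall>i\<in>J. \<forall>j\<in>J. B i j = (\<Sum>s<r. mv J M (w s) i * mv J M (w s) j)"
proof -
  obtain r :: nat and b where b: "\<forall>i\<in>J. \<forall>j\<in>J. B i j = (\<Sum>s<r. b s i * b s j)"
    using psd_sum_of_outer[OF assms(1,3,4)] by blast
  have "\<exists>w. \<forall>i\<in>J. b s i = mv J M w i" if s: "s < r" for s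
  proof (rule in_range_if_orthogonal_to_kernel[OF assms(1,2)])
    fix x assume "\<And>i. i \<in> J \<Longrightarrow> mv J M x i = 0"
    then have "qf J B x = 0" using assms(5) unfolding ker_le_def by (intro mv_zero_qf) blast
    moreover have "qf J B x = qf J (\<lambda>i j. \<Sum>s<r. b s i * b s j) x"
      using b by (intro qf_cong) auto
    ultimately have "(\<Sum>s<r. (\<Sum>i\<in>J. x i * b s i)\<^sup>2) = 0" unfolding qf_sum qf_outer by simp
    then have "\<forall>s\<in>{..<r}. (\<Sum>i\<in>J. x i * b s i)\<^sup>2 = 0"
      by (subst (asm) sum_nonneg_eq_0_iff) auto
    then show "(\<Sum>i\<in>J. b s i * x i) = 0" using s by (simp add: mult.commute)
  qed
  then obtain w where w: "\<And>s i. s < r \<Longrightarrow> i \<in> J \<Longrightarrow> b s i = mv J M (w s) i" by metis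
  show ?thesis using b w by (intro exI[of _ r] exI[of _ w]) simp
qed

text \<open>By Cauchy-Schwarz the square of \<open>v . M w\<close> is at most
  \<open>(w . M w) * (v . M v)\<close>; summing over the decomposition of \<open>B\<close> yields
  \<open>c\<close>. This is the sense in which \<open>M\<close> is relatively interior to its
  face.\<close>

lemma psd_face_bound:
  assumes "finite J" "symm M" "psd J M" "symm B" "psd J B" "ker_le J M B"
  shows "\<exists>c\<ge>0. psd J (\<lambda>i j. c * M i j + (- 1) * B i j)"
proof -
  obtain r :: nat and w where w: "\<forall>i\<in>J. \<forall>j\<in>J. B i j = (\<Sum>s<r. mv J M (w s) i * mv J M (w s) j)"
    using psd_face_decomp[OF assms(1,2,4,5,6)] by blast
  define c where "c = (\<Sum>s<r. qf J M (w s))"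
  have "qf J B v \<le> c * qf J M v" for v
  proof -
    have "qf J B v = qf J (\<lambda>i j. \<Sum>s<r. mv J M (w s) i * mv J M (w s) j) v"
      using w by (intro qf_cong) auto
    also have "\<dots> = (\<Sum>s<r. (\<Sum>i\<in>J. v i * mv J M (w s) i)\<^sup>2)" unfolding qf_sum qf_outer ..
    also have "\<dots> \<le> (\<Sum>s<r. qf J M (w s) * qf J M v)"
      by (intro sum_mono psd_cauchy assms)
    finally show ?thesis unfolding c_def sum_distrib_right .
  qed
  moreover have "0 \<le> c" using assms(3) unfolding c_def psd_def by (intro sum_nonneg) auto
  ultimately show ?thesis unfolding psd_def qf_lincomb by (intro exI[of _ c]) auto
qed

lemma symm_aff: "(\<And>l. symm (A l)) \<Longrightarrow> symm (\<lambda>i j. aff N (\<lambda>l. A l i j) z)"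
  unfolding symm_def by (intro allI arg_cong[where f = "\<lambda>c. aff N c z"] ext) blast

text \<open>The average of two feasible matrices is feasible, and its kernel is the intersection of
  the two kernels. Finitely many averages reach the common kernel of all feasible matrices, since
  finitely many rows determine it.\<close>

lemma exists_minimal_kernel:
  assumes J: "finite J" and A: "\<And>l. symm (A l)" and "psd J (\<lambda>i j. aff N (\<lambda>l. A l i j) z1)"
  shows "\<exists>z0. psd J (\<lambda>i j. aff N (\<lambda>l. A l i j) z0) \<and>
    (\<forall>z. psd J (\<lambda>i j. aff N (\<lambda>l. A l i j) z) \<longrightarrow>
      ker_le J (\<lambda>i j. aff N (\<lambda>l. A l i j) z0) (\<lambda>i j. aff N (\<lambda>l. A l i j) z))"
proof -
  define ev where "ev z = (\<lambda>i j. aff N (\<lambda>l. A l i j) z)" for z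
  have sy: "symm (ev z)" for z unfolding ev_def by (rule symm_aff[OF A])
  \<comment> \<open>The rows of all feasible matrices, read as linear forms; their common zeros are
    the intersection of all kernels.\<close>
  define R where "R = {ev z i | z i. psd J (ev z) \<and> i \<in> J}"
  obtain F where F: "finite F" "F \<subseteq> R"
    "\<And>x. \<forall>r\<in>F. (\<Sum>i\<in>J. r i * x i) = 0 \<Longrightarrow> \<forall>r\<in>R. (\<Sum>i\<in>J. r i * x i) = 0"
    using finitely_many_forms[OF J, of R] by blast
  have "\<exists>z0. psd J (ev z0) \<and> (\<forall>x. (\<forall>i\<in>J. mv J (ev z0) x i = 0) \<longrightarrow> (\<forall>r\<in>F. (\<Sum>i\<in>J. r i * x i) = 0))"
    using F(1,2)
  proof (induction F rule: finite_induct)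
    case empty
    then show ?case using assms(3) unfolding ev_def by blast
  next
    case (insert r F)
    then obtain z0 where z0: "psd J (ev z0)"
      "\<And>x. \<forall>i\<in>J. mv J (ev z0) x i = 0 \<Longrightarrow> \<forall>r\<in>F. (\<Sum>i\<in>J. r i * x i) = 0" by auto
    obtain z i where z: "r = ev z i" "psd J (ev z)" "i \<in> J" using insert.prems unfolding R_def by auto
    define y where "y = (\<lambda>i. 1/2 * z0 i + 1/2 * z i)"
    have y: "ev y = (\<lambda>i j. 1/2 * ev z0 i j + 1/2 * ev z i j)"
      unfolding ev_def y_def by (intro ext aff_convex) simp
    have "psd J (ev y)" unfolding y by (intro psd_lincomb z0 z) auto
    moreover have "(\<Sum>i\<in>J. r' i * x i) = 0"
      if x: "\<forall>i\<in>J. mv J (ev y) x i = 0" and r': "r' \<in> insert r F" for x r'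
    proof -
      have "qf J (ev y) x = 0" using x by (intro mv_zero_qf) auto
      then have "qf J (ev z0) x + qf J (ev z) x = 0" unfolding y qf_lincomb by simp
      moreover have "0 \<le> qf J (ev z0) x" "0 \<le> qf J (ev z) x" using z0 z unfolding psd_def by auto
      ultimately have "qf J (ev z0) x = 0" "qf J (ev z) x = 0" by auto
      then have "\<forall>i\<in>J. mv J (ev z0) x i = 0" "\<forall>i\<in>J. mv J (ev z) x i = 0"
        using psd_qf_eq_0[OF sy _ J] z0 z by blast+
      then show ?thesis using z0(2)[of x] r' z unfolding mv_def by auto
    qed
    ultimately show ?case by blast
  qed
  then obtain z0 where z0: "psd J (ev z0)"
    "\<And>x. \<forall>i\<in>J. mv J (ev z0) x i = 0 \<Longrightarrow> \<forall>r\<in>F. (\<Sum>i\<in>J. r i * x i) = 0" by blast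
  have "ker_le J (ev z0) (ev z)" if "psd J (ev z)" for z
    unfolding ker_le_def
  proof (intro allI impI ballI)
    fix x i assume "\<forall>i\<in>J. mv J (ev z0) x i = 0" "i \<in> J"
    then have "\<forall>r\<in>R. (\<Sum>i\<in>J. r i * x i) = 0" using z0(2) F(3) by blast
    then show "mv J (ev z) x i = 0" using that \<open>i \<in> J\<close> unfolding R_def mv_def by blast
  qed
  then show ?thesis using z0(1) unfolding ev_def by blast
qed

text \<open>Weak duality pairs \<open>U\<close> with the decomposition of \<open>ev z\<close> over
  the face. For the converse, validity of the inequality says that \<open>B = ev z\<close> and
  \<open>aff N g z = t\<close> have no common solution with \<open>B\<close> in the face and
  \<open>t > 0\<close>. Separating the differences from the origin yields \<open>U\<close> and a
  weight \<open>\<mu>\<close> for the objective; dividing by \<open>\<mu>\<close>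
  normalizes.\<close>

lemma lmi_duality:
  fixes A :: "nat \<Rightarrow> 'j \<Rightarrow> 'j \<Rightarrow> real" and N :: nat
  defines "ev \<equiv> \<lambda>z i j. aff N (\<lambda>l. A l i j) z"
  assumes J: "finite J" and A: "\<And>l. symm (A l)" and z0: "psd J (ev z0)"
    and ker: "\<And>z. psd J (ev z) \<Longrightarrow> ker_le J (ev z0) (ev z)"
  shows "(\<forall>z. psd J (ev z) \<longrightarrow> aff N g z \<le> 0) \<longleftrightarrow>
    (\<exists>U. (\<forall>w. 0 \<le> pairing J U (\<lambda>i j. mv J (ev z0) w i * mv J (ev z0) w j)) \<and>
      (\<forall>l<N. pairing J U (A (Suc l)) + g (Suc l) = 0) \<and> pairing J U (A 0) + g 0 \<le> 0)"
    (is "?L \<longleftrightarrow> ?R")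
proof -
  define M where "M = ev z0"
  have sy: "symm (ev z)" for z unfolding ev_def by (rule symm_aff[OF A])
  have sM: "symm M" and pM: "psd J M" unfolding M_def using sy z0 by auto
  have pev: "pairing J U (ev z) = aff N (\<lambda>l. pairing J U (A l)) z" for U z
    unfolding ev_def by (rule pairing_aff)
  \<comment> \<open>\<open>c = 1\<close> gives the dual constraints; \<open>c = 0\<close> serves the
    case in which the objective gets no weight.\<close>
  have coeff: "(\<forall>z. pairing J U (ev z) + c * aff N g z \<le> 0) \<longleftrightarrow>
      (\<forall>l<N. pairing J U (A (Suc l)) + c * g (Suc l) = 0) \<and> pairing J U (A 0) + c * g 0 \<le> 0" for U c
    using aff_nonpos_iff[of N "\<lambda>l. pairing J U (A l) + c * g l"]
      aff_lincomb[of N 1 "\<lambda>l. pairing J U (A l)" c g] unfolding pev by auto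
  define K where "K = {B. symm B \<and> psd J B \<and> ker_le J M B}"
  have K_lin: "(\<lambda>i j. a * B i j + b * C i j) \<in> K" if "B \<in> K" "C \<in> K" "0 \<le> a" "0 \<le> b" for a b B C
    using that unfolding K_def by (simp add: symm_lincomb psd_lincomb ker_le_lincomb)
  have MK: "M \<in> K" unfolding K_def ker_le_def using sM pM by simp
  have zK: "(\<lambda>i j. 0) \<in> K" unfolding K_def ker_le_def symm_def psd_def qf_def mv_def by simp
  have outerK: "(\<lambda>i j. mv J M w i * mv J M w j) \<in> K" for w
  proof -
    have "mv J (\<lambda>i j. mv J M w i * mv J M w j) x i = 0" if "\<forall>i\<in>J. mv J M x i = 0" for x i
    proof -
      have "mv J (\<lambda>i j. mv J M w i * mv J M w j) x i = mv J M w i * (\<Sum>j\<in>J. mv J M w j * x j)"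
        unfolding mv_def[of J "\<lambda>i j. mv J M w i * mv J M w j"] by (simp add: sum_distrib_left mult.assoc)
      also have "(\<Sum>j\<in>J. mv J M w j * x j) = 0"
        unfolding mv_adjoint[OF sM, symmetric] using that by simp
      finally show ?thesis by simp
    qed
    moreover have "psd J (\<lambda>i j. mv J M w i * mv J M w j)"
      unfolding psd_def using qf_outer[of J "mv J M w"] by simp
    ultimately show ?thesis unfolding K_def ker_le_def symm_def by (simp add: mult.commute)
  qed
  show ?thesis
  proof
    assume ?R
    then obtain U where U: "\<And>w. 0 \<le> pairing J U (\<lambda>i j. mv J M w i * mv J M w j)"
      and "(\<forall>l<N. pairing J U (A (Suc l)) + g (Suc l) = 0) \<and> pairing J U (A 0) + g 0 \<le> 0"
      unfolding M_def by blast
    then have le: "pairing J U (ev z) + aff N g z \<le> 0" for z using coeff[of U 1] by auto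
    show ?L
    proof (intro allI impI)
      fix z assume p: "psd J (ev z)"
      obtain r :: nat and w where w: "\<forall>i\<in>J. \<forall>j\<in>J. ev z i j = (\<Sum>s<r. mv J M (w s) i * mv J M (w s) j)"
        using psd_face_decomp[OF J sM sy p] ker[OF p] unfolding M_def by blast
      have "pairing J U (ev z) = pairing J U (\<lambda>i j. \<Sum>s<r. mv J M (w s) i * mv J M (w s) j)"
        using w by (intro pairing_cong) auto
      also have "\<dots> \<ge> 0" unfolding pairing_sum using U by (intro sum_nonneg) auto
      finally show "aff N g z \<le> 0" using le[of z] by simp
    qed
  next
    assume L: ?L
    \<comment> \<open>A matrix and a number become one vector, to which separation in coordinates
      applies; index \<open>None\<close> holds the number.\<close>
    define enc :: "('j \<Rightarrow> 'j \<Rightarrow> real) \<Rightarrow> real \<Rightarrow> ('j \<times> 'j) option \<Rightarrow> real" where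
      "enc B t = (\<lambda>q. case q of None \<Rightarrow> t | Some (i, j) \<Rightarrow> B i j)" for B t
    define I where "I = insert None (Some ` (J \<times> J))"
    define D where "D = {enc (\<lambda>i j. B i j - ev z i j) (t - aff N g z) | B z t. B \<in> K \<and> 0 < t}"
    have DI: "enc (\<lambda>i j. B i j - ev z i j) (t - aff N g z) \<in> D" if "B \<in> K" "0 < t" for B z t
      unfolding D_def using that by blast
    have fin: "finite I" using J unfolding I_def by simp
    have "cvx D" unfolding cvx_def
    proof (intro ballI allI impI)
      fix x y and a b :: real
      assume xy: "x \<in> D" "y \<in> D" and ab: "0 \<le> a" "0 \<le> b" "a + b = 1"
      obtain B z t where x: "x = enc (\<lambda>i j. B i j - ev z i j) (t - aff N g z)" "B \<in> K" "0 < t"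
        using xy unfolding D_def by blast
      obtain B' z' t' where y: "y = enc (\<lambda>i j. B' i j - ev z' i j) (t' - aff N g z')" "B' \<in> K" "0 < t'"
        using xy unfolding D_def by blast
      let ?z = "\<lambda>i. a * z i + b * z' i"
      have "(\<lambda>i. a * x i + b * y i) = enc (\<lambda>i j. (a * B i j + b * B' i j) - ev ?z i j)
          ((a * t + b * t') - aff N g ?z)"
        unfolding x y enc_def ev_def aff_convex[OF ab(3)]
        by (intro ext) (simp add: right_diff_distrib split: option.split)
      moreover have pos: "0 < a * t + b * t'"
      proof (cases "a = 0")
        case False
        then have "0 < a * t" using ab x by simp
        then show ?thesis using ab y by (simp add: add_pos_nonneg)
      qed (use ab y in simp)
      ultimately show "(\<lambda>i. a * x i + b * y i) \<in> D"
        using DI[OF K_lin[OF x(2) y(2) ab(1,2)] pos, of ?z] by simp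
    qed
    moreover have "D \<noteq> {}"
    proof -
      show ?thesis using DI[OF MK, of 1] by auto
    qed
    moreover have "\<exists>i\<in>I. x i \<noteq> 0" if xD: "x \<in> D" for x
    proof (rule ccontr)
      assume no: "\<not> (\<exists>i\<in>I. x i \<noteq> 0)"
      obtain B z t where x: "x = enc (\<lambda>i j. B i j - ev z i j) (t - aff N g z)" "B \<in> K" "0 < t"
        using xD unfolding D_def by blast
      have "B i j = ev z i j" if "i \<in> J" "j \<in> J" for i j
      proof -
        have "x (Some (i, j)) = 0" using no that unfolding I_def by blast
        then show ?thesis by (simp add: x enc_def)
      qed
      then have "psd J (ev z)" using x(2) psd_cong[of J B "ev z"] unfolding K_def by simp
      moreover have "x None = 0" using no unfolding I_def by blast
      then have "t = aff N g z" by (simp add: x enc_def)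
      ultimately show False using L x(3) by force
    qed
    ultimately obtain u where u: "\<And>x. x \<in> D \<Longrightarrow> 0 \<le> (\<Sum>i\<in>I. u i * x i)"
        "\<exists>x\<in>D. 0 < (\<Sum>i\<in>I. u i * x i)"
      using proper_separation_from_zero[OF fin, of D] by blast
    define U where "U = (\<lambda>i j. u (Some (i, j)))"
    define \<mu> where "\<mu> = u None"
    have enc: "(\<Sum>i\<in>I. u i * enc B t i) = \<mu> * t + pairing J U B" for B t
    proof -
      have "(\<Sum>i\<in>I. u i * enc B t i) = \<mu> * t + (\<Sum>i\<in>Some ` (J \<times> J). u i * enc B t i)"
        unfolding I_def \<mu>_def using J by (simp add: enc_def image_iff)
      also have "(\<Sum>i\<in>Some ` (J \<times> J). u i * enc B t i) = (\<Sum>p\<in>J \<times> J. u (Some p) * enc B t (Some p))"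
        by (subst sum.reindex) auto
      also have "\<dots> = pairing J U B"
        unfolding pairing_def U_def enc_def by (simp add: sum.cartesian_product split_def)
      finally show ?thesis .
    qed
    have ge: "0 \<le> \<mu> * (t - aff N g z) + (pairing J U B - pairing J U (ev z))" if "B \<in> K" "0 < t" for B z t
      using u(1)[OF DI[OF that, of z]] unfolding enc pairing_diff .
    obtain B1 z1 t1 where strict: "B1 \<in> K" "0 < t1"
      "0 < \<mu> * (t1 - aff N g z1) + (pairing J U B1 - pairing J U (ev z1))"
      using u(2) unfolding D_def by (auto simp: enc pairing_diff)
    have pz: "pairing J U (\<lambda>i j. 0) = 0" unfolding pairing_def by simp
    \<comment> \<open>Otherwise a large multiple of \<open>B\<close>, still in the cone, would
      violate \<open>ge\<close>.\<close>
    have UK: "0 \<le> pairing J U B" if B: "B \<in> K" for B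
    proof (rule ccontr)
      assume n: "\<not> 0 \<le> pairing J U B"
      define C where "C = \<mu> * (1 - aff N g z0) - pairing J U (ev z0)"
      define s where "s = (\<bar>C\<bar> + 1) / (- pairing J U B)"
      have s: "0 \<le> s" "s * pairing J U B = - \<bar>C\<bar> - 1" using n unfolding s_def by (auto simp: field_simps)
      have "(\<lambda>i j. s * B i j) \<in> K" using K_lin[OF B zK s(1), of 0] by simp
      from ge[OF this, of 1 z0] have "0 \<le> C + s * pairing J U B"
        using pairing_lincomb[of J U s B 0 B] unfolding C_def by simp
      then show False using s(2) by simp
    qed
    \<comment> \<open>\<open>ge\<close> with \<open>B = 0\<close> and small \<open>t\<close>. Since
      the sign of \<open>\<mu>\<close> is still unknown, \<open>t\<close> is chosen from its
      absolute value, which makes \<open>\<mu> * t\<close> at most \<open>C / 2\<close>.\<close>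
    have lim: "pairing J U (ev z) + \<mu> * aff N g z \<le> 0" for z
    proof (rule ccontr)
      assume n: "\<not> ?thesis"
      define C where "C = pairing J U (ev z) + \<mu> * aff N g z"
      have "0 < C" using n unfolding C_def by simp
      define t where "t = C / (2 * (\<bar>\<mu>\<bar> + 1))"
      have t: "0 < t" unfolding t_def using \<open>0 < C\<close> by simp
      have "\<mu> * t \<le> \<bar>\<mu>\<bar> * t" using t by (intro mult_right_mono) auto
      also have "\<dots> \<le> (\<bar>\<mu>\<bar> + 1) * t" using t by (simp add: distrib_right)
      also have "\<dots> = C / 2" unfolding t_def by (simp add: field_simps)
      finally have "\<mu> * t < C" using \<open>0 < C\<close> by simp
      then show False using ge[OF zK t, of z] unfolding pz C_def by (simp add: right_diff_distrib)
    qed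
    \<comment> \<open>\<open>ge\<close> with \<open>B = 0\<close> and large
      \<open>t\<close>.\<close>
    have \<mu>0: "0 \<le> \<mu>"
    proof (rule ccontr)
      assume n: "\<not> 0 \<le> \<mu>"
      define C where "C = pairing J U (ev z0) + \<mu> * aff N g z0"
      define t where "t = (\<bar>C\<bar> + 1) / (- \<mu>)"
      have t: "0 < t" "\<mu> * t = - \<bar>C\<bar> - 1" using n unfolding t_def by (auto simp: field_simps)
      show False using ge[OF zK t(1), of z0] t(2) unfolding pz C_def by (simp add: right_diff_distrib)
    qed
    text \<open>
      If \<open>\<mu> = 0\<close>, then \<open>U\<close> vanishes on \<open>M\<close>, which is relatively interior to the cone \<open>K\<close>, hence on
      all of \<open>K\<close> and on the values of \<open>ev\<close>, so the separation is not proper.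
    \<close>
    have "\<mu> \<noteq> 0"
    proof
      assume m: "\<mu> = 0"
      have le: "pairing J U (ev z) \<le> 0" for z using lim[of z] m by simp
      have UM: "pairing J U M = 0" using le[of z0] UK[OF MK] unfolding M_def by simp
      have "(\<forall>l<N. pairing J U (A (Suc l)) = 0)"
        using coeff[of U 0] le by auto
      then have const: "pairing J U (ev z) = pairing J U (A 0)" for z unfolding pev aff_def by simp
      have ev0: "pairing J U (ev z) = 0" for z using const[of z] const[of z0] UM unfolding M_def by simp
      obtain c where c: "0 \<le> c" "psd J (\<lambda>i j. c * M i j + (- 1) * B1 i j)"
        using psd_face_bound[OF J sM pM] strict(1) unfolding K_def by blast
      then have "(\<lambda>i j. c * M i j + (- 1) * B1 i j) \<in> K"
        using strict(1) MK symm_lincomb[of M B1 c "- 1"] ker_le_lincomb[of J M M B1 c "- 1"]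
        unfolding K_def by blast
      from UK[OF this] have "pairing J U B1 \<le> 0" unfolding pairing_lincomb UM by simp
      then show False using strict(3) m ev0[of z1] by simp
    qed
    then have \<mu>: "0 < \<mu>" using \<mu>0 by simp
    have "pairing J (\<lambda>i j. U i j / \<mu>) (ev z) + 1 * aff N g z \<le> 0" for z
    proof -
      have "(pairing J U (ev z) + \<mu> * aff N g z) / \<mu> \<le> 0"
        using lim[of z] \<mu> by (simp add: divide_nonpos_pos)
      then show ?thesis using \<mu> by (simp add: pairing_scale add_divide_distrib)
    qed
    then have "(\<forall>l<N. pairing J (\<lambda>i j. U i j / \<mu>) (A (Suc l)) + 1 * g (Suc l) = 0) \<and>
        pairing J (\<lambda>i j. U i j / \<mu>) (A 0) + 1 * g 0 \<le> 0"
      using coeff[of "\<lambda>i j. U i j / \<mu>" 1] by blast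
    moreover have "0 \<le> pairing J (\<lambda>i j. U i j / \<mu>) (\<lambda>i j. mv J M w i * mv J M w j)" for w
      unfolding pairing_scale using UK[OF outerK] \<mu> by simp
    ultimately show ?R unfolding M_def by (intro exI[of _ "\<lambda>i j. U i j / \<mu>"]) simp
  qed
qed


section \<open>Projections of spectrahedra\<close>

lemma aff_cong:
  "(\<And>l. l \<le> N \<Longrightarrow> c l = d l) \<Longrightarrow> (\<And>i. i < N \<Longrightarrow> x i = y i) \<Longrightarrow> aff N c x = aff N d y"
  unfolding aff_def by (auto intro!: arg_cong2[of _ _ _ _ "(+)"] sum.cong)

lemma aff_append: "aff (n + m) c z = aff n c z + (\<Sum>l<m. z (n + l) * c (Suc (n + l)))"
  by (induction m) (simp_all add: aff_def)

lemma pos_semidef_lmp_eval_iff: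
  assumes "\<And>l. symm (a l)" and "\<And>l i j. l \<le> N \<Longrightarrow> i < k \<Longrightarrow> j < k \<Longrightarrow> A l $$ (i, j) = a l i j"
  shows "pos_semidef k (lmp_eval k N A z) \<longleftrightarrow> psd {..<k} (\<lambda>i j. aff N (\<lambda>l. a l i j) z)"
proof -
  define M where "M = lmp_eval k N A z"
  define B where "B = (\<lambda>i j. aff N (\<lambda>l. a l i j) z)"
  have M: "M \<in> carrier_mat k k" unfolding M_def lmp_eval_def by simp
  have ent: "M $$ (i, j) = B i j" if "i < k" "j < k" for i j
    unfolding M_def lmp_eval_def B_def aff_def using that assms(2) by simp
  have "symm B" unfolding B_def by (rule symm_aff[OF assms(1)])
  then have "transpose_mat M = M"
    using M ent by (intro eq_matI) (auto simp: symmD[of B])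
  moreover have quad: "scalar_prod v (M *\<^sub>v v) = qf {..<k} B (\<lambda>i. v $ i)" if "v \<in> carrier_vec k" for v
    using that M ent unfolding qf_mv mv_def scalar_prod_def
    by (auto simp: scalar_prod_def lessThan_atLeast0 intro!: sum.cong)
  moreover have "(\<forall>v \<in> carrier_vec k. 0 \<le> qf {..<k} B (\<lambda>i. v $ i)) \<longleftrightarrow> psd {..<k} B"
  proof
    assume *: "\<forall>v \<in> carrier_vec k. 0 \<le> qf {..<k} B (\<lambda>i. v $ i)"
    show "psd {..<k} B" unfolding psd_def
    proof
      fix w
      have "qf {..<k} B w = qf {..<k} B (\<lambda>i. vec k w $ i)" by (intro qf_cong) auto
      then show "0 \<le> qf {..<k} B w" using * by auto
    qed
  qed (simp add: psd_def)
  ultimately show ?thesis using M unfolding pos_semidef_def M_def[symmetric] B_def[symmetric] by auto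
qed

text \<open>
  Here \<open>z\<close> ranges over all functions: only its coordinates below \<open>N\<close> enter \<^const>\<open>aff\<close>.
\<close>

lemma projected_spectrahedron_iff:
  "projected_spectrahedron n S \<longleftrightarrow> (\<exists>N (k::nat) A. n \<le> N \<and> (\<forall>l. symm (A l)) \<and>
    S = {x \<in> topspace (Euclidean_space n).
      \<exists>z. (\<forall>i<n. z i = x i) \<and> psd {..<k} (\<lambda>i j. aff N (\<lambda>l. A l i j) z)})"
  (is "_ \<longleftrightarrow> ?R")
proof
  assume "projected_spectrahedron n S"
  then obtain m k A where A: "linear_matrix_polynomial k (n + m) A"
    and S: "S = {x \<in> topspace (Euclidean_space n). \<exists>y \<in> topspace (Euclidean_space m).
      join_point n x y \<in> {z \<in> topspace (Euclidean_space (n + m)). pos_semidef k (lmp_eval k (n + m) A z)}}"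
    unfolding projected_spectrahedron_def spectrahedron_def by blast
  \<comment> \<open>Extension by zero makes the symmetry hold at all indices.\<close>
  define a where "a l i j = (if l \<le> n + m \<and> i < k \<and> j < k then A l $$ (i, j) else 0)" for l i j
  have "A l $$ (i, j) = A l $$ (j, i)" if "l \<le> n + m" "i < k" "j < k" for l i j
    using A that unfolding linear_matrix_polynomial_def
    by (metis carrier_matD index_transpose_mat(1))
  then have sy: "symm (a l)" for l unfolding symm_def a_def by auto
  have ps: "pos_semidef k (lmp_eval k (n + m) A z) \<longleftrightarrow> psd {..<k} (\<lambda>i j. aff (n + m) (\<lambda>l. a l i j) z)" for z
    by (rule pos_semidef_lmp_eval_iff[OF sy]) (simp add: a_def)
  have "(\<exists>y \<in> topspace (Euclidean_space m).
      join_point n x y \<in> {z \<in> topspace (Euclidean_space (n + m)). pos_semidef k (lmp_eval k (n + m) A z)})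
    \<longleftrightarrow> (\<exists>z. (\<forall>i<n. z i = x i) \<and> psd {..<k} (\<lambda>i j. aff (n + m) (\<lambda>l. a l i j) z))" for x
  proof
    assume "\<exists>z. (\<forall>i<n. z i = x i) \<and> psd {..<k} (\<lambda>i j. aff (n + m) (\<lambda>l. a l i j) z)"
    then obtain z where z: "\<forall>i<n. z i = x i" "psd {..<k} (\<lambda>i j. aff (n + m) (\<lambda>l. a l i j) z)" by blast
    \<comment> \<open>Points of \<open>Euclidean_space m\<close> vanish from index \<open>m\<close>
      on, whereas \<open>z\<close> is arbitrary beyond \<open>n + m\<close>.\<close>
    define y where "y i = (if i < m then z (n + i) else 0)" for i
    have "aff (n + m) c (join_point n x y) = aff (n + m) c z" for c
      using z(1) by (intro aff_cong) (auto simp: join_point_def y_def)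
    then have "pos_semidef k (lmp_eval k (n + m) A (join_point n x y))" using z(2) unfolding ps by simp
    then show "\<exists>y \<in> topspace (Euclidean_space m).
      join_point n x y \<in> {z \<in> topspace (Euclidean_space (n + m)). pos_semidef k (lmp_eval k (n + m) A z)}"
      by (intro bexI[of _ y]) (auto simp: topspace_Euclidean_space join_point_def y_def)
  next
    assume "\<exists>y \<in> topspace (Euclidean_space m).
      join_point n x y \<in> {z \<in> topspace (Euclidean_space (n + m)). pos_semidef k (lmp_eval k (n + m) A z)}"
    then obtain y where "psd {..<k} (\<lambda>i j. aff (n + m) (\<lambda>l. a l i j) (join_point n x y))" unfolding ps by blast
    then show "\<exists>z. (\<forall>i<n. z i = x i) \<and> psd {..<k} (\<lambda>i j. aff (n + m) (\<lambda>l. a l i j) z)"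
      by (intro exI[of _ "join_point n x y"]) (simp add: join_point_def)
  qed
  then have S': "S = {x \<in> topspace (Euclidean_space n).
      \<exists>z. (\<forall>i<n. z i = x i) \<and> psd {..<k} (\<lambda>i j. aff (n + m) (\<lambda>l. a l i j) z)}" unfolding S by simp
  show ?R
    by (rule exI[of _ "n + m"], rule exI[of _ k], rule exI[of _ a]) (intro conjI allI le_add1 sy S')
next
  assume ?R
  then obtain N and k :: nat and a where N: "n \<le> N" and sy: "\<And>l. symm (a l)" and
    S: "S = {x \<in> topspace (Euclidean_space n).
      \<exists>z. (\<forall>i<n. z i = x i) \<and> psd {..<k} (\<lambda>i j. aff N (\<lambda>l. a l i j) z)}" by blast
  define m where "m = N - n"
  have Nm: "N = n + m" using N unfolding m_def by simp
  define A where "A l = mat k k (\<lambda>(i, j). a l i j)" for l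
  have "linear_matrix_polynomial k N A" unfolding linear_matrix_polynomial_def A_def
    by (auto intro!: eq_matI simp: symmD[OF sy])
  then have sp: "spectrahedron N {z \<in> topspace (Euclidean_space N). pos_semidef k (lmp_eval k N A z)}"
    unfolding spectrahedron_def by blast
  have ps: "pos_semidef k (lmp_eval k N A z) \<longleftrightarrow> psd {..<k} (\<lambda>i j. aff N (\<lambda>l. a l i j) z)" for z
    by (rule pos_semidef_lmp_eval_iff[OF sy]) (simp add: A_def)
  have "(\<exists>z. (\<forall>i<n. z i = x i) \<and> psd {..<k} (\<lambda>i j. aff N (\<lambda>l. a l i j) z)) \<longleftrightarrow>
    (\<exists>y \<in> topspace (Euclidean_space m).
      join_point n x y \<in> {z \<in> topspace (Euclidean_space N). pos_semidef k (lmp_eval k N A z)})" for x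
  proof
    assume "\<exists>z. (\<forall>i<n. z i = x i) \<and> psd {..<k} (\<lambda>i j. aff N (\<lambda>l. a l i j) z)"
    then obtain z where z: "\<forall>i<n. z i = x i" "psd {..<k} (\<lambda>i j. aff N (\<lambda>l. a l i j) z)" by blast
    define y where "y i = (if i < m then z (n + i) else 0)" for i
    have "aff N c (join_point n x y) = aff N c z" for c
      using z(1) unfolding Nm by (intro aff_cong) (auto simp: join_point_def y_def)
    then have "pos_semidef k (lmp_eval k N A (join_point n x y))" using z(2) unfolding ps by simp
    then show "\<exists>y \<in> topspace (Euclidean_space m).
      join_point n x y \<in> {z \<in> topspace (Euclidean_space N). pos_semidef k (lmp_eval k N A z)}"
      by (intro bexI[of _ y]) (auto simp: topspace_Euclidean_space join_point_def y_def Nm)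
  next
    assume "\<exists>y \<in> topspace (Euclidean_space m).
      join_point n x y \<in> {z \<in> topspace (Euclidean_space N). pos_semidef k (lmp_eval k N A z)}"
    then obtain y where "psd {..<k} (\<lambda>i j. aff N (\<lambda>l. a l i j) (join_point n x y))" unfolding ps by blast
    then show "\<exists>z. (\<forall>i<n. z i = x i) \<and> psd {..<k} (\<lambda>i j. aff N (\<lambda>l. a l i j) z)"
      by (intro exI[of _ "join_point n x y"]) (simp add: join_point_def)
  qed
  then show "projected_spectrahedron n S"
    unfolding projected_spectrahedron_def S using sp unfolding Nm by blast
qed

section \<open>Flexible forms of a linear matrix inequality\<close>

lemma qf_reindex:
  assumes "bij_betw h I J"
  shows "qf J B w = qf I (\<lambda>i j. B (h i) (h j)) (\<lambda>i. w (h i))"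
  unfolding qf_def by (simp add: sum.reindex_bij_betw[OF assms, symmetric])

lemma psd_reindex:
  assumes "bij_betw h I J"
  shows "psd J B \<longleftrightarrow> psd I (\<lambda>i j. B (h i) (h j))"
proof
  assume *: "psd J B"
  show "psd I (\<lambda>i j. B (h i) (h j))" unfolding psd_def
  proof
    fix w
    have "qf I (\<lambda>i j. B (h i) (h j)) w = qf J B (\<lambda>j. w (inv_into I h j))"
      unfolding qf_reindex[OF assms] using bij_betw_inv_into_left[OF assms] by (intro qf_cong) auto
    then show "0 \<le> qf I (\<lambda>i j. B (h i) (h j)) w" using * unfolding psd_def by simp
  qed
qed (auto simp: psd_def qf_reindex[OF assms])

text \<open>A quadratic form does not see the antisymmetric part.\<close>

lemma psd_symmetrize: "psd J (\<lambda>i j. (B i j + B j i) / 2) \<longleftrightarrow> psd J B"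
proof -
  have "qf J (\<lambda>i j. B j i) w = qf J B w" for w
    unfolding qf_def by (subst sum.swap) (simp add: mult_ac)
  then have "qf J (\<lambda>i j. (B i j + B j i) / 2) w = qf J B w" for w
    using qf_lincomb[of J "1/2" B "1/2" "\<lambda>i j. B j i" w] by (simp add: add_divide_distrib)
  then show ?thesis unfolding psd_def by simp
qed

text \<open>Allows index sets of any type for the matrix and for the auxiliary variables, and
  coefficients without symmetry. Enumeration of the index sets and symmetrization lead back to
  \<open>projected_spectrahedron_iff\<close>.\<close>

lemma projected_spectrahedron_lmi:
  fixes P :: "'a set" and J :: "'b set"
  assumes P: "finite P" and J: "finite J"
  shows "projected_spectrahedron n {x \<in> topspace (Euclidean_space n).
    \<exists>y. psd J (\<lambda>i j. aff n (\<lambda>l. a l i j) x + (\<Sum>p\<in>P. y p * c p i j))}"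
proof -
  obtain g :: "nat \<Rightarrow> 'a" and m where g: "bij_betw g {..<m} P"
    using ex_bij_betw_nat_finite[OF P] by (auto simp: lessThan_atLeast0)
  obtain h :: "nat \<Rightarrow> 'b" and k where h: "bij_betw h {..<k} J"
    using ex_bij_betw_nat_finite[OF J] by (auto simp: lessThan_atLeast0)
  \<comment> \<open>Coefficients \<open>0\<close> to \<open>n\<close> belong to the constant and to
    \<open>x\<close>. Coordinate \<open>n + q\<close> has coefficient \<open>Suc (n + q)\<close>,
    hence the shift by \<open>Suc n\<close>.\<close>
  define b where "b l i j = (if l \<le> n then a l (h i) (h j) else c (g (l - Suc n)) (h i) (h j))" for l i j
  define A where "A l i j = (b l i j + b l j i) / 2" for l i j
  have half: "aff (n + m) (\<lambda>l. A l i j) z = (aff (n + m) (\<lambda>l. b l i j) z + aff (n + m) (\<lambda>l. b l j i) z) / 2" for i j z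
    unfolding A_def using aff_lincomb[of "n + m" "1/2" "\<lambda>l. b l i j" "1/2" "\<lambda>l. b l j i" z]
    by (simp add: add_divide_distrib)
  have sym: "psd {..<k} (\<lambda>i j. aff (n + m) (\<lambda>l. A l i j) z) \<longleftrightarrow> psd {..<k} (\<lambda>i j. aff (n + m) (\<lambda>l. b l i j) z)" for z
    unfolding half by (rule psd_symmetrize)
  have ev: "aff (n + m) (\<lambda>l. b l i j) z = aff n (\<lambda>l. a l (h i) (h j)) z + (\<Sum>q<m. z (n + q) * c (g q) (h i) (h j))" for z i j
    unfolding aff_append by (intro arg_cong2[of _ _ _ _ "(+)"] aff_cong) (auto simp: b_def)
  have "(\<exists>y. psd J (\<lambda>i j. aff n (\<lambda>l. a l i j) x + (\<Sum>p\<in>P. y p * c p i j))) \<longleftrightarrow>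
    (\<exists>z. (\<forall>i<n. z i = x i) \<and> psd {..<k} (\<lambda>i j. aff (n + m) (\<lambda>l. A l i j) z))" for x
  proof
    assume "\<exists>y. psd J (\<lambda>i j. aff n (\<lambda>l. a l i j) x + (\<Sum>p\<in>P. y p * c p i j))"
    then obtain y where y: "psd J (\<lambda>i j. aff n (\<lambda>l. a l i j) x + (\<Sum>p\<in>P. y p * c p i j))" by blast
    define z where "z i = (if i < n then x i else y (g (i - n)))" for i
    have "aff n d z = aff n d x" for d by (rule aff_cong) (auto simp: z_def)
    then have "psd {..<k} (\<lambda>i j. aff (n + m) (\<lambda>l. b l i j) z)"
      using y unfolding ev psd_reindex[OF h] sum.reindex_bij_betw[OF g, symmetric] by (simp add: z_def)
    then show "\<exists>z. (\<forall>i<n. z i = x i) \<and> psd {..<k} (\<lambda>i j. aff (n + m) (\<lambda>l. A l i j) z)"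
      unfolding sym by (intro exI[of _ z]) (simp add: z_def)
  next
    assume "\<exists>z. (\<forall>i<n. z i = x i) \<and> psd {..<k} (\<lambda>i j. aff (n + m) (\<lambda>l. A l i j) z)"
    then obtain z where z: "\<forall>i<n. z i = x i" "psd {..<k} (\<lambda>i j. aff (n + m) (\<lambda>l. b l i j) z)"
      unfolding sym by blast
    have x: "aff n d z = aff n d x" for d using z(1) by (intro aff_cong) auto
    define y where "y p = z (n + inv_into {..<m} g p)" for p
    have "y (g q) = z (n + q)" if "q < m" for q
      using bij_betw_inv_into_left[OF g, of q] that by (simp add: y_def)
    then have "psd J (\<lambda>i j. aff n (\<lambda>l. a l i j) x + (\<Sum>p\<in>P. y p * c p i j))"
      using z(2) unfolding ev psd_reindex[OF h] sum.reindex_bij_betw[OF g, symmetric] x by simp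
    then show "\<exists>y. psd J (\<lambda>i j. aff n (\<lambda>l. a l i j) x + (\<Sum>p\<in>P. y p * c p i j))" by blast
  qed
  then have eq: "{x \<in> topspace (Euclidean_space n). \<exists>y. psd J (\<lambda>i j. aff n (\<lambda>l. a l i j) x + (\<Sum>p\<in>P. y p * c p i j))} =
    {x \<in> topspace (Euclidean_space n). \<exists>z. (\<forall>i<n. z i = x i) \<and> psd {..<k} (\<lambda>i j. aff (n + m) (\<lambda>l. A l i j) z)}"
    by simp
  have sy: "symm (A l)" for l unfolding symm_def A_def by (simp add: add.commute)
  show ?thesis unfolding projected_spectrahedron_iff
    by (rule exI[of _ "n + m"], rule exI[of _ k], rule exI[of _ A]) (intro conjI allI le_add1 sy eq)
qed

text \<open>Each scalar inequality is a diagonal block of size 1; vectors supported in a single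
  block recover the separate conditions.\<close>

lemma psd_block_diagonal:
  assumes J: "finite J" and E: "finite E"
  shows "psd (J <+> E) (\<lambda>i j. case i of
      Inl i \<Rightarrow> (case j of Inl j \<Rightarrow> B i j | Inr _ \<Rightarrow> 0)
    | Inr e \<Rightarrow> (case j of Inl _ \<Rightarrow> 0 | Inr e' \<Rightarrow> if e = e' then d e else 0)) \<longleftrightarrow>
    psd J B \<and> (\<forall>e\<in>E. 0 \<le> d e)" (is "psd _ ?C \<longleftrightarrow> _")
proof -
  have q: "qf (J <+> E) ?C w = qf J B (\<lambda>i. w (Inl i)) + (\<Sum>e\<in>E. w (Inr e) * w (Inr e) * d e)" for w
    unfolding qf_def using J E by (simp add: sum.Plus if_distrib[of "\<lambda>x. _ * x"] cong: if_cong)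
  show ?thesis
  proof
    assume *: "psd (J <+> E) ?C"
    have "0 \<le> qf J B w" for w
      using *[unfolded psd_def q, rule_format, of "case_sum w (\<lambda>_. 0)"] by simp
    moreover have "0 \<le> d e" if "e \<in> E" for e
    proof -
      have "(\<Sum>e'\<in>E. (if e' = e then 1 else 0) * (if e' = e then 1 else 0) * d e') = d e"
        using E that by (simp add: if_distrib[of "\<lambda>x. x * _"] cong: if_cong)
      then show ?thesis
        using *[unfolded psd_def q, rule_format, of "case_sum (\<lambda>_. 0) (\<lambda>e'. if e' = e then 1 else 0)"]
        by (simp add: qf_def)
    qed
    ultimately show "psd J B \<and> (\<forall>e\<in>E. 0 \<le> d e)" unfolding psd_def by blast
  next
    assume "psd J B \<and> (\<forall>e\<in>E. 0 \<le> d e)"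
    then show "psd (J <+> E) ?C" unfolding psd_def q by (auto intro!: add_nonneg_nonneg sum_nonneg)
  qed
qed

text \<open>The shape of the dual conditions: the matrix condition involves only the multiplier,
  while the parameter \<open>x\<close> enters through scalar inequalities.\<close>

lemma projected_spectrahedron_lmi_ineqs:
  fixes P :: "'a set" and J :: "'b set" and E :: "'e set"
  assumes "finite P" and J: "finite J" and E: "finite E"
  shows "projected_spectrahedron n {x \<in> topspace (Euclidean_space n). \<exists>y.
    psd J (\<lambda>i j. \<Sum>p\<in>P. y p * c p i j) \<and>
    (\<forall>e\<in>E. 0 \<le> aff n (f e) x + (\<Sum>p\<in>P. y p * h p e))}"
proof -
  define blk :: "('b \<Rightarrow> 'b \<Rightarrow> real) \<Rightarrow> ('e \<Rightarrow> real) \<Rightarrow> 'b + 'e \<Rightarrow> 'b + 'e \<Rightarrow> real" where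
    "blk B d = (\<lambda>i j. case i of
      Inl i \<Rightarrow> (case j of Inl j \<Rightarrow> B i j | Inr _ \<Rightarrow> 0)
    | Inr e \<Rightarrow> (case j of Inl _ \<Rightarrow> 0 | Inr e' \<Rightarrow> if e = e' then d e else 0))" for B d
  have "aff n (\<lambda>l. blk (\<lambda>_ _. 0) (\<lambda>e. f e l) i j) x + (\<Sum>p\<in>P. y p * blk (c p) (h p) i j)
    = blk (\<lambda>i j. \<Sum>p\<in>P. y p * c p i j) (\<lambda>e. aff n (f e) x + (\<Sum>p\<in>P. y p * h p e)) i j" for x y i j
    unfolding blk_def by (auto simp: aff_def split: sum.split)
  then have "psd (J <+> E) (\<lambda>i j. aff n (\<lambda>l. blk (\<lambda>_ _. 0) (\<lambda>e. f e l) i j) x + (\<Sum>p\<in>P. y p * blk (c p) (h p) i j)) \<longleftrightarrow>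
    psd J (\<lambda>i j. \<Sum>p\<in>P. y p * c p i j) \<and> (\<forall>e\<in>E. 0 \<le> aff n (f e) x + (\<Sum>p\<in>P. y p * h p e))" for x y
    using psd_block_diagonal[OF J E, of "\<lambda>i j. \<Sum>p\<in>P. y p * c p i j" "\<lambda>e. aff n (f e) x + (\<Sum>p\<in>P. y p * h p e)"]
    unfolding blk_def[symmetric] by simp
  then show ?thesis
    using projected_spectrahedron_lmi[OF assms(1) finite_Plus[OF J E], of n "\<lambda>l. blk (\<lambda>_ _. 0) (\<lambda>e. f e l)" "\<lambda>p. blk (c p) (h p)"]
    by simp
qed

text \<open>The value is \<open>w . (M^T U M) w\<close>, so nonnegativity for all \<open>w\<close>
  is semidefiniteness of a matrix that is linear in \<open>U\<close>.\<close>

lemma pairing_outer: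
  assumes "finite J"
  shows "pairing J U (\<lambda>i j. mv J M w i * mv J M w j) = qf J (\<lambda>p q. \<Sum>(i, j)\<in>J \<times> J. U i j * (M i p * M j q)) w"
proof -
  have entry: "u * (mv J M w i * mv J M w j) = qf J (\<lambda>p q. u * (M i p * M j q)) w" for u i j
    unfolding mv_def qf_def by (subst sum_product) (simp add: sum_distrib_left mult_ac)
  have "pairing J U (\<lambda>i j. mv J M w i * mv J M w j) = (\<Sum>(i, j)\<in>J \<times> J. U i j * (mv J M w i * mv J M w j))"
    unfolding pairing_def by (simp add: sum.cartesian_product)
  also have "\<dots> = (\<Sum>(i, j)\<in>J \<times> J. qf J (\<lambda>p q. U i j * (M i p * M j q)) w)"
    unfolding entry ..
  also have "\<dots> = qf J (\<lambda>p q. \<Sum>(i, j)\<in>J \<times> J. U i j * (M i p * M j q)) w"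
    using qf_sum[of J "\<lambda>ij p q. U (fst ij) (snd ij) * (M (fst ij) p * M (snd ij) q)" "J \<times> J" w]
    by (simp add: split_def)
  finally show ?thesis .
qed

text \<open>As the coefficients of the inequality are affine in \<open>x\<close>, the dual
  conditions are a linear matrix inequality jointly in \<open>x\<close> and \<open>U\<close>.
  Leaving \<open>G\<close> free allows two applications with different roles for the
  variables.\<close>

lemma projected_spectrahedron_dual:
  assumes "projected_spectrahedron p T"
  shows "projected_spectrahedron n {x \<in> topspace (Euclidean_space n).
    \<forall>t\<in>T. aff p (\<lambda>l. aff n (G l) x) t \<le> 0}"
proof -
  obtain N and k :: nat and A where N: "p \<le> N" and A: "\<And>l. symm (A l)"
    and T: "T = {t \<in> topspace (Euclidean_space p).
      \<exists>z. (\<forall>i<p. z i = t i) \<and> psd {..<k} (\<lambda>i j. aff N (\<lambda>l. A l i j) z)}"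
    using assms unfolding projected_spectrahedron_iff by blast
  define ev where "ev z = (\<lambda>i j. aff N (\<lambda>l. A l i j) z)" for z
  \<comment> \<open>The inequality ignores the projected-out coordinates, so their coefficients are
    0.\<close>
  define g where "g x l = (if l \<le> p then aff n (G l) x else 0)" for x l
  have gz: "aff N (g x) z = aff p (\<lambda>l. aff n (G l) x) z" for x z
  proof -
    have "aff N (g x) z = aff (p + (N - p)) (g x) z" using N by simp
    also have "\<dots> = aff p (g x) z" unfolding aff_append by (simp add: g_def)
    also have "\<dots> = aff p (\<lambda>l. aff n (G l) x) z" by (rule aff_cong) (auto simp: g_def)
    finally show ?thesis .
  qed
  have dual: "(\<forall>t\<in>T. aff p (\<lambda>l. aff n (G l) x) t \<le> 0) \<longleftrightarrow> (\<forall>z. psd {..<k} (ev z) \<longrightarrow> aff N (g x) z \<le> 0)" for x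
  proof
    assume *: "\<forall>t\<in>T. aff p (\<lambda>l. aff n (G l) x) t \<le> 0"
    show "\<forall>z. psd {..<k} (ev z) \<longrightarrow> aff N (g x) z \<le> 0"
    proof (intro allI impI)
      fix z assume "psd {..<k} (ev z)"
      then have "(\<lambda>i. if i < p then z i else 0) \<in> T"
        unfolding T ev_def by (auto simp: topspace_Euclidean_space intro!: exI[of _ z])
      then have "aff p (\<lambda>l. aff n (G l) x) (\<lambda>i. if i < p then z i else 0) \<le> 0" using * by blast
      also have "aff p (\<lambda>l. aff n (G l) x) (\<lambda>i. if i < p then z i else 0) = aff N (g x) z"
        unfolding gz by (rule aff_cong) auto
      finally show "aff N (g x) z \<le> 0" .
    qed
  next
    assume *: "\<forall>z. psd {..<k} (ev z) \<longrightarrow> aff N (g x) z \<le> 0"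
    show "\<forall>t\<in>T. aff p (\<lambda>l. aff n (G l) x) t \<le> 0"
    proof
      fix t assume "t \<in> T"
      then obtain z where z: "\<forall>i<p. z i = t i" "psd {..<k} (ev z)" unfolding T ev_def by blast
      then have "aff p (\<lambda>l. aff n (G l) x) z \<le> 0" using * unfolding gz by blast
      then show "aff p (\<lambda>l. aff n (G l) x) t \<le> 0"
        using z(1) aff_cong[of p "\<lambda>l. aff n (G l) x" "\<lambda>l. aff n (G l) x" z t] by simp
    qed
  qed
  show ?thesis
  proof (cases "\<exists>z. psd {..<k} (ev z)")
    \<comment> \<open>\<open>T\<close> is empty and every inequality is valid: the set is the whole
      space, given by an empty matrix inequality.\<close>
    case False
    then have "\<forall>t\<in>T. aff p (\<lambda>l. aff n (G l) x) t \<le> 0" for x unfolding dual by blast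
    then show ?thesis
      using projected_spectrahedron_lmi[of "{}::nat set" "{}::nat set" n "\<lambda>_ _ _. 0" "\<lambda>_ _ _. 0"]
      by (simp add: psd_def qf_def)
  next
    case True
    then obtain z0 where z0: "psd {..<k} (ev z0)"
      and ker: "\<And>z. psd {..<k} (ev z) \<Longrightarrow> ker_le {..<k} (ev z0) (ev z)"
      using exists_minimal_kernel[of "{..<k}" A N, OF finite_lessThan A] unfolding ev_def by blast
    define M where "M = ev z0"
    define P where "P = {..<k} \<times> {..<k}"
    text \<open>The equation at each index \<open>l > 0\<close> is a pair of inequalities; index \<open>0\<close> carries one inequality.\<close>
    define E where "E = {..N} \<times> {True, False}"
    \<comment> \<open>The factor 0 makes the second inequality at index \<open>0\<close>
      trivial.\<close>
    define \<sigma> :: "nat \<times> bool \<Rightarrow> real" where "\<sigma> e = (if snd e then - 1 else if fst e = 0 then 0 else 1)" for e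
    define f where "f e l' = \<sigma> e * (if fst e \<le> p then G (fst e) l' else 0)" for e l'
    define c where "c ij q r = M (fst ij) q * M (snd ij) r" for ij q r
    define h where "h ij e = \<sigma> e * A (fst e) (fst ij) (snd ij)" for ij e
    have f: "aff n (f e) x = \<sigma> e * g x (fst e)" for e x
      unfolding f_def g_def by (auto simp: aff_mult aff_def)
    have sgn: "(\<forall>e\<in>E. 0 \<le> \<sigma> e * v (fst e)) \<longleftrightarrow> (\<forall>l<N. v (Suc l) = 0) \<and> v 0 \<le> 0" for v
    proof
      assume *: "\<forall>e\<in>E. 0 \<le> \<sigma> e * v (fst e)"
      have nn: "0 \<le> \<sigma> (l, b) * v l" if "l \<le> N" for l b
        using *[rule_format, of "(l, b)"] that unfolding E_def by simp
      have "v (Suc l) = 0" if "l < N" for l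
        using nn[of "Suc l" True] nn[of "Suc l" False] that by (simp add: \<sigma>_def)
      then show "(\<forall>l<N. v (Suc l) = 0) \<and> v 0 \<le> 0"
        using nn[of 0 True] by (simp add: \<sigma>_def)
    next
      assume *: "(\<forall>l<N. v (Suc l) = 0) \<and> v 0 \<le> 0"
      have "0 \<le> \<sigma> (l, b) * v l" if "l \<le> N" for l b
        using * that by (cases l) (auto simp: \<sigma>_def)
      then show "\<forall>e\<in>E. 0 \<le> \<sigma> e * v (fst e)" unfolding E_def by auto
    qed
    have "(\<exists>y. psd {..<k} (\<lambda>q r. \<Sum>ij\<in>P. y ij * c ij q r) \<and>
        (\<forall>e\<in>E. 0 \<le> aff n (f e) x + (\<Sum>ij\<in>P. y ij * h ij e))) \<longleftrightarrow>
      (\<forall>t\<in>T. aff p (\<lambda>l. aff n (G l) x) t \<le> 0)" for x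
    proof -
      have lin: "aff n (f e) x + (\<Sum>ij\<in>P. y ij * h ij e) =
          \<sigma> e * (pairing {..<k} (\<lambda>i j. y (i, j)) (A (fst e)) + g x (fst e))" for y e
        unfolding f h_def P_def pairing_def
        by (simp add: sum.cartesian_product sum_distrib_left distrib_left split_def mult.left_commute)
      have mat: "psd {..<k} (\<lambda>q r. \<Sum>ij\<in>P. y ij * c ij q r) \<longleftrightarrow>
          (\<forall>w. 0 \<le> pairing {..<k} (\<lambda>i j. y (i, j)) (\<lambda>i j. mv {..<k} M w i * mv {..<k} M w j))" for y
        unfolding pairing_outer[OF finite_lessThan] psd_def c_def P_def by (simp add: split_def)
      \<comment> \<open>The auxiliary variables are indexed by pairs, while \<open>U\<close> is
        curried.\<close>
      have cur: "(\<exists>y. Q (\<lambda>i j. y (i, j))) \<longleftrightarrow> (\<exists>U. Q U)" for Q :: "(nat \<Rightarrow> nat \<Rightarrow> real) \<Rightarrow> bool"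
      proof
        assume "\<exists>U. Q U"
        then obtain U where "Q U" by blast
        then have "Q (\<lambda>i j. case_prod U (i, j))" by simp
        then show "\<exists>y. Q (\<lambda>i j. y (i, j))" by blast
      qed blast
      have lmi: "(\<forall>z. psd {..<k} (ev z) \<longrightarrow> aff N (g x) z \<le> 0) \<longleftrightarrow>
        (\<exists>U. (\<forall>w. 0 \<le> pairing {..<k} U (\<lambda>i j. mv {..<k} M w i * mv {..<k} M w j)) \<and>
          (\<forall>l<N. pairing {..<k} U (A (Suc l)) + g x (Suc l) = 0) \<and> pairing {..<k} U (A 0) + g x 0 \<le> 0)"
        unfolding M_def ev_def
        by (rule lmi_duality[of "{..<k}" A N z0, OF finite_lessThan A])
          (use z0 ker in \<open>simp_all add: ev_def\<close>)
      show ?thesis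
        unfolding lin mat dual sgn[of "\<lambda>l. pairing {..<k} (\<lambda>i j. _ (i, j)) (A l) + g x l"] lmi
        by (rule cur)
    qed
    then show ?thesis
      using projected_spectrahedron_lmi_ineqs[of P "{..<k}" E n c f h] unfolding P_def E_def by simp
  qed
qed


section \<open>The closure as an intersection of half-spaces\<close>

lemma Euclidean_space_box_nbhd:
  assumes "openin (Euclidean_space n) U" "x \<in> U"
  shows "\<exists>\<epsilon>>0. \<forall>y \<in> topspace (Euclidean_space n). (\<forall>i<n. \<bar>y i - x i\<bar> < \<epsilon>) \<longrightarrow> y \<in> U"
proof -
  obtain V where V: "openin (powertop_real UNIV) V" "U = V \<inter> {x. \<forall>i\<ge>n. x i = 0}"
    using assms(1) unfolding Euclidean_space_def openin_subtopology by blast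
  obtain X where X: "x \<in> (\<Pi>\<^sub>E i\<in>UNIV. X i)" "\<And>i. open (X i)" "(\<Pi>\<^sub>E i\<in>UNIV. X i) \<subseteq> V"
    using product_topology_open_contains_basis[OF V(1), of x] assms(2) V(2) by auto
  have "\<exists>e>0. \<forall>r. \<bar>r - x i\<bar> < e \<longrightarrow> r \<in> X i" for i
    using X(1,2) open_dist[of "X i"] by (auto simp: dist_real_def)
  then obtain e where e: "\<And>i. 0 < e i" "\<And>i r. \<bar>r - x i\<bar> < e i \<Longrightarrow> r \<in> X i" by metis
  \<comment> \<open>Finitely many radii suffice because points of the space are 0 at all other
    coordinates. The 1 keeps the set nonempty for \<open>n = 0\<close>.\<close>
  define \<epsilon> where "\<epsilon> = Min (insert 1 (e ` {..<n}))"
  have \<epsilon>: "0 < \<epsilon>" "\<And>i. i < n \<Longrightarrow> \<epsilon> \<le> e i" unfolding \<epsilon>_def using e(1) by auto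
  have "y \<in> U" if y: "y \<in> topspace (Euclidean_space n)" "\<forall>i<n. \<bar>y i - x i\<bar> < \<epsilon>" for y
  proof -
    have "y i \<in> X i" for i
    proof (cases "i < n")
      case True
      then show ?thesis using y(2) \<epsilon>(2)[of i] by (intro e(2)) fastforce
    next
      case False
      then have "y i = x i" using y(1) assms(2) V(2) by (simp add: topspace_Euclidean_space)
      then show ?thesis using X(1) by auto
    qed
    then show ?thesis using X(3) y(1) V(2) by (auto simp: topspace_Euclidean_space)
  qed
  then show ?thesis using \<epsilon>(1) by blast
qed

lemma closedin_halfspace:
  "closedin (Euclidean_space n) {x \<in> topspace (Euclidean_space n). (\<Sum>i<n. l i * x i) \<le> (c::real)}"
proof -
  have "closed {x::nat \<Rightarrow> real. (\<Sum>i<n. l i * x i) \<le> c}"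
    by (intro closed_Collect_le continuous_intros continuous_on_product_coordinates)
  moreover have "closed (topspace (Euclidean_space n))"
    using closedin_Euclidean_imp_closed closedin_topspace by blast
  ultimately have "closed (topspace (Euclidean_space n) \<inter> {x. (\<Sum>i<n. l i * x i) \<le> c})"
    by (rule closed_Int[rotated])
  then show ?thesis unfolding closedin_Euclidean_space_iff by (auto simp: Collect_conj_eq)
qed

text \<open>If a box around \<open>x\<close> misses \<open>S\<close>, the differences of points of
  \<open>S\<close> and of the box miss the origin. The width of the box turns proper separation into
  a half-space that contains \<open>S\<close> but not \<open>x\<close>.\<close>

lemma closure_of_convex_halfspaces:
  assumes S: "S \<subseteq> topspace (Euclidean_space n)" "cvx S"
  shows "Euclidean_space n closure_of S = {x \<in> topspace (Euclidean_space n).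
    \<forall>l c. (\<forall>s\<in>S. (\<Sum>i<n. l i * s i) \<le> c) \<longrightarrow> (\<Sum>i<n. l i * x i) \<le> c}" (is "_ = ?R")
proof
  show "Euclidean_space n closure_of S \<subseteq> ?R"
  proof
    fix x assume x: "x \<in> Euclidean_space n closure_of S"
    have "(\<Sum>i<n. l i * x i) \<le> c" if "\<forall>s\<in>S. (\<Sum>i<n. l i * s i) \<le> c" for l c
      using closure_of_minimal[OF _ closedin_halfspace, of S n l c] S(1) that x by auto
    then show "x \<in> ?R" using x by (auto simp: in_closure_of)
  qed
next
  show "?R \<subseteq> Euclidean_space n closure_of S"
  proof (rule subsetI, rule ccontr)
    fix x assume x: "x \<in> ?R" and "x \<notin> Euclidean_space n closure_of S"
    then obtain U where U: "openin (Euclidean_space n) U" "x \<in> U" "U \<inter> S = {}"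
      unfolding in_closure_of by blast
    obtain \<epsilon> where \<epsilon>: "0 < \<epsilon>"
      and box: "\<And>y. y \<in> topspace (Euclidean_space n) \<Longrightarrow> \<forall>i<n. \<bar>y i - x i\<bar> < \<epsilon> \<Longrightarrow> y \<in> U"
      using Euclidean_space_box_nbhd[OF U(1,2)] by blast
    \<comment> \<open>\<open>y\<close> is restricted only below \<open>n\<close>; further
      coordinates do not enter the separating functional.\<close>
    define D where "D = {\<lambda>i. s i - y i | s y. s \<in> S \<and> (\<forall>i<n. \<bar>y i - x i\<bar> < \<epsilon>)}"
    have DI: "(\<lambda>i. s i - y i) \<in> D" if "s \<in> S" "\<forall>i<n. \<bar>y i - x i\<bar> < \<epsilon>" for s y
      using that unfolding D_def by blast
    have x_le: "(\<Sum>i<n. l i * x i) \<le> c" if "\<forall>s\<in>S. (\<Sum>i<n. l i * s i) \<le> c" for l c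
      using x that by blast
    \<comment> \<open>On an empty \<open>S\<close> the inequality \<open>0 <= - 1\<close> would be
      valid and hence hold at \<open>x\<close>.\<close>
    have "S \<noteq> {}" using x_le[of "\<lambda>_. 0" "- 1"] by auto
    then have "D \<noteq> {}" using DI[of _ x] \<epsilon> by auto
    moreover have "cvx D" unfolding cvx_def
    proof (intro ballI allI impI)
      fix p q and a b :: real
      assume pq: "p \<in> D" "q \<in> D" and ab: "0 \<le> a" "0 \<le> b" "a + b = 1"
      obtain s y where p: "p = (\<lambda>i. s i - y i)" "s \<in> S" "\<forall>i<n. \<bar>y i - x i\<bar> < \<epsilon>"
        using pq unfolding D_def by blast
      obtain s' y' where q: "q = (\<lambda>i. s' i - y' i)" "s' \<in> S" "\<forall>i<n. \<bar>y' i - x i\<bar> < \<epsilon>"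
        using pq unfolding D_def by blast
      have "\<bar>(a * y i + b * y' i) - x i\<bar> < \<epsilon>" if "i < n" for i
      proof -
        have "x i = a * x i + b * x i" using ab(3) by (metis distrib_right mult_1)
        then have "\<bar>(a * y i + b * y' i) - x i\<bar> = \<bar>a * (y i - x i) + b * (y' i - x i)\<bar>"
          by (simp add: algebra_simps)
        also have "\<dots> < \<epsilon>" using p(3) q(3) that ab convex_bound_lt[of "\<bar>y i - x i\<bar>" \<epsilon> "\<bar>y' i - x i\<bar>" a b]
          by (intro order.strict_trans1[OF abs_triangle_ineq]) (simp add: abs_mult)
        finally show ?thesis .
      qed
      from DI[OF cvxD[OF S(2) p(2) q(2) ab], of "\<lambda>i. a * y i + b * y' i"] this
      show "(\<lambda>i. a * p i + b * q i) \<in> D" unfolding p q by (simp add: algebra_simps)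
    qed
    moreover have "\<exists>i\<in>{..<n}. d i \<noteq> 0" if "d \<in> D" for d
    proof (rule ccontr)
      assume no: "\<not> (\<exists>i\<in>{..<n}. d i \<noteq> 0)"
      from \<open>d \<in> D\<close> obtain s y where d: "d = (\<lambda>i. s i - y i)" "s \<in> S" "\<forall>i<n. \<bar>y i - x i\<bar> < \<epsilon>"
        unfolding D_def by blast
      have "\<forall>i<n. \<bar>s i - x i\<bar> < \<epsilon>" using no d(3) unfolding d(1) by auto
      then have "s \<in> U" using S(1) d(2) by (intro box) auto
      then show False using U(3) d(2) by blast
    qed
    ultimately obtain u where u: "\<And>d. d \<in> D \<Longrightarrow> 0 \<le> (\<Sum>i<n. u i * d i)" "\<exists>d\<in>D. 0 < (\<Sum>i<n. u i * d i)"
      using proper_separation_from_zero[OF finite_lessThan, of D n] by blast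
    have "\<exists>j<n. u j \<noteq> 0"
    proof (rule ccontr)
      assume "\<not> ?thesis"
      then show False using u(2) by simp
    qed
    then have pos: "0 < (\<Sum>i<n. \<bar>u i\<bar>)" by (auto intro: sum_pos2)
    \<comment> \<open>A maximizer of \<open>u\<close> on the box of half the size; it exceeds the
      value at \<open>x\<close> by \<open>\<epsilon> / 2\<close> times the 1-norm of
      \<open>u\<close>.\<close>
    define y where "y = (\<lambda>i. x i + \<epsilon> / 2 * sgn (u i))"
    define c where "c = - (\<Sum>i<n. u i * x i) - \<epsilon> / 2 * (\<Sum>i<n. \<bar>u i\<bar>)"
    have y: "\<forall>i<n. \<bar>y i - x i\<bar> < \<epsilon>" unfolding y_def using \<epsilon> by (auto simp: sgn_real_def)
    have uy: "u i * y i = u i * x i + \<epsilon> / 2 * \<bar>u i\<bar>" for i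
      unfolding y_def by (simp add: distrib_left abs_sgn)
    have "(\<Sum>i<n. (- u i) * s i) \<le> c" if "s \<in> S" for s
    proof -
      have "0 \<le> (\<Sum>i<n. u i * s i) - (\<Sum>i<n. u i * y i)"
        using u(1)[OF DI[OF that y]] by (simp add: right_diff_distrib sum_subtractf)
      then show ?thesis unfolding c_def uy sum.distrib by (simp add: sum_negf sum_distrib_left)
    qed
    then have "(\<Sum>i<n. (- u i) * x i) \<le> c" by (intro x_le) blast
    then have "\<epsilon> / 2 * (\<Sum>i<n. \<bar>u i\<bar>) \<le> 0" unfolding c_def by (simp add: sum_negf)
    moreover have "0 < \<epsilon> / 2 * (\<Sum>i<n. \<bar>u i\<bar>)" using \<epsilon> pos by simp
    ultimately show False by linarith
  qed
qed

lemma projected_spectrahedron_convex: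
  assumes "projected_spectrahedron n S"
  shows "S \<subseteq> topspace (Euclidean_space n)" "cvx S"
proof -
  obtain N and k :: nat and A where S: "S = {x \<in> topspace (Euclidean_space n).
      \<exists>z. (\<forall>i<n. z i = x i) \<and> psd {..<k} (\<lambda>i j. aff N (\<lambda>l. A l i j) z)}"
    using assms unfolding projected_spectrahedron_iff by blast
  show "S \<subseteq> topspace (Euclidean_space n)" unfolding S by blast
  show "cvx S" unfolding cvx_def
  proof (intro ballI allI impI)
    fix x y and a b :: real
    assume xy: "x \<in> S" "y \<in> S" and ab: "0 \<le> a" "0 \<le> b" "a + b = 1"
    obtain z where z: "\<forall>i<n. z i = x i" "psd {..<k} (\<lambda>i j. aff N (\<lambda>l. A l i j) z)"
      using xy(1) unfolding S by blast
    obtain z' where z': "\<forall>i<n. z' i = y i" "psd {..<k} (\<lambda>i j. aff N (\<lambda>l. A l i j) z')"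
      using xy(2) unfolding S by blast
    have "psd {..<k} (\<lambda>i j. aff N (\<lambda>l. A l i j) (\<lambda>i. a * z i + b * z' i))"
      unfolding aff_convex[OF ab(3)] by (rule psd_lincomb[OF z(2) z'(2) ab(1,2)])
    then show "(\<lambda>i. a * x i + b * y i) \<in> S"
      using xy z(1) z'(1) unfolding S
      by (auto simp: topspace_Euclidean_space intro!: exI[of _ "\<lambda>i. a * z i + b * z' i"])
  qed
qed

theorem corollary3p4:
  fixes n :: nat and S :: "(nat \<Rightarrow> real) set"
  assumes "projected_spectrahedron n S"
  shows "projected_spectrahedron n (Euclidean_space n closure_of S)"
proof -
  \<comment> \<open>A point \<open>t\<close> with \<open>n + 1\<close> coordinates encodes an
    inequality whose right-hand side is \<open>t n\<close>. \<open>G\<close> lists the coefficients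
    of \<open>(\<Sum>i<n. t i * s i) - t n\<close> as a function of \<open>s\<close>, each affine in
    \<open>t\<close>; \<open>H\<close> lists those of the same expression as a function of
    \<open>t\<close>, each affine in the point. Coordinate \<open>i\<close> has coefficient index
    \<open>Suc i\<close> throughout.\<close>
  define G :: "nat \<Rightarrow> nat \<Rightarrow> real" where
    "G l m = (if l = 0 then (if m = Suc n then - 1 else 0) else if m = l then 1 else 0)" for l m
  define H :: "nat \<Rightarrow> nat \<Rightarrow> real" where
    "H l m = (if l = Suc n then (if m = 0 then - 1 else 0) else if l \<noteq> 0 \<and> m = l then 1 else 0)" for l m
  define T where "T = {t \<in> topspace (Euclidean_space (Suc n)). \<forall>s\<in>S. aff n (\<lambda>l. aff (Suc n) (G l) t) s \<le> 0}"
  have "aff (Suc n) (G 0) t = - t n" for t unfolding aff_def by (simp add: G_def)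
  moreover have "aff (Suc n) (G (Suc i)) t = t i" if "i < n" for i t
    using that unfolding aff_def by (simp add: G_def if_distrib[of "\<lambda>x. _ * x"] cong: if_cong)
  ultimately have G: "aff n (\<lambda>l. aff (Suc n) (G l) t) s = (\<Sum>i<n. t i * s i) - t n" for t s
    unfolding aff_def[of n] by (simp add: mult.commute)
  have "aff n (H 0) x = 0" "aff n (H (Suc n)) x = - 1" for x unfolding aff_def by (simp_all add: H_def)
  moreover have "aff n (H (Suc i)) x = x i" if "i < n" for i x
    using that unfolding aff_def by (simp add: H_def if_distrib[of "\<lambda>x. _ * x"] cong: if_cong)
  ultimately have H: "aff (Suc n) (\<lambda>l. aff n (H l) x) t = (\<Sum>i<n. t i * x i) - t n" for x t
    unfolding aff_def[of "Suc n"] by simp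
  have "projected_spectrahedron (Suc n) T"
    unfolding T_def by (rule projected_spectrahedron_dual[OF assms])
  then have "projected_spectrahedron n {x \<in> topspace (Euclidean_space n).
      \<forall>t\<in>T. aff (Suc n) (\<lambda>l. aff n (H l) x) t \<le> 0}"
    by (rule projected_spectrahedron_dual)
  moreover have "(\<forall>t\<in>T. aff (Suc n) (\<lambda>l. aff n (H l) x) t \<le> 0) \<longleftrightarrow>
      (\<forall>l c. (\<forall>s\<in>S. (\<Sum>i<n. l i * s i) \<le> c) \<longrightarrow> (\<Sum>i<n. l i * x i) \<le> c)" for x
  proof
    assume *: "\<forall>t\<in>T. aff (Suc n) (\<lambda>l. aff n (H l) x) t \<le> 0"
    show "\<forall>l c. (\<forall>s\<in>S. (\<Sum>i<n. l i * s i) \<le> c) \<longrightarrow> (\<Sum>i<n. l i * x i) \<le> c"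
    proof (intro allI impI)
      fix l c assume lc: "\<forall>s\<in>S. (\<Sum>i<n. l i * s i) \<le> c"
      define t where "t i = (if i < n then l i else if i = n then c else 0)" for i
      have "t \<in> T" using lc unfolding T_def G by (auto simp: t_def topspace_Euclidean_space)
      then show "(\<Sum>i<n. l i * x i) \<le> c" using * unfolding H by (auto simp: t_def)
    qed
  next
    assume "\<forall>l c. (\<forall>s\<in>S. (\<Sum>i<n. l i * s i) \<le> c) \<longrightarrow> (\<Sum>i<n. l i * x i) \<le> c"
    then show "\<forall>t\<in>T. aff (Suc n) (\<lambda>l. aff n (H l) x) t \<le> 0"
      unfolding T_def G H by auto
  qed
  ultimately show ?thesis
    unfolding closure_of_convex_halfspaces[OF projected_spectrahedron_convex[OF assms]] by simp
qed

end
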